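(* Let $\mathbf r=\{r^{(c)}\}_{c\in C}$ be a family of classical r-matrices for a Lie bialgebra $(\mathfrak g,\delta)$, let $n\in\mathbb Z_{>1}$, let $\mathbf c=(c_{i,j})_{1\le i<j\le n}$ be a transitive $n$-array with entries in $C$, and let $G$ be an algebraic Poisson-Lie group with Lie algebra $\mathfrak g$. Then the diagonal embedding $G\hookrightarrow G^{\times n}$ is Poisson, that is, the multiplication map $\Bbbk[G]^{\otimes n}\to\Bbbk[G]$ is a homomorphism of Poisson algebras, where $\Bbbk[G]$ carries the Poisson structure induced by $\delta$ and $\Bbbk[G]^{\otimes n}\cong\Bbbk[G^{\times n}]$ carries the Poisson structure induced by the Lie cobracket $\tilde\delta_{\mathbf c}$ on $\mathfrak g^{\oplus n}$ corresponding to $\mathbf r$ and $\mathbf c$.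
   Context: The base field $\Bbbk$ has characteristic zero. For a Lie algebra $\mathfrak l$, $\Delta:U(\mathfrak l)\to U(\mathfrak l)\otimes U(\mathfrak l)$ is the standard comultiplication, $\mathfrak l\otimes\mathfrak l\subset U(\mathfrak l)\otimes U(\mathfrak l)$; $\tau_{i,j}$ swaps tensor factors $i$ and $j$. For $x=\sum_t a_t\otimes b_t\in\mathfrak l\otimes\mathfrak l$ and distinct $i,j$, $x_{i,j}\in U(\mathfrak l)^{\otimes m}$ has $a_t$ in position $i$, $b_t$ in position $j$ and $1$ elsewhere (summed over $t$). A Lie cobracket on $\mathfrak l$ is a linear map $\delta:\mathfrak l\to\mathfrak l\otimes\mathfrak l$ with $\delta([x,y])=[\delta(x),\Delta(y)]-[\delta(y),\Delta(x)]$, $\tau_{1,2}\circ\delta=-\delta$ and $(\mathrm{id}+\tau_{1,2}\tau_{2,3}+\tau_{2,3}\tau_{1,2})\circ(\delta\otimes\mathrm{id})\circ\delta=0$. An r-matrix for $(\mathfrak l,\delta)$ is $r\in\mathfrak l\otimes\mathfrak l$ with $\delta(x)=[r,\Delta(x)]$ for $x\in\mathfrak l$ and $[r_{1,2},r_{1,3}]+[r_{1,2},r_{2,3}]+[r_{1,3},r_{2,3}]=0$. All $r^{(c)}$ are r-matrices for the same $\delta$. $\mathbf c$ is transitive if $c_{i,k}\in\{c_{i,j},c_{j,k}\}$ for all $1\le i<j<k\le n$. With $U(\mathfrak g^{\oplus n})=U(\mathfrak g)^{\otimes n}$, the cobracket $\tilde\delta_{\mathbf c}$ on $\mathfrak g^{\oplus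 n}$ is $\tilde\delta_{\mathbf c}(x)=[\mathbf r(\mathbf c,\boldsymbol d),1\otimes x+x\otimes 1]$, where $\mathbf r(\mathbf c,\boldsymbol d)=\sum_{i}(r^{(d_i)})_{i,i+n}+\sum_{i<j}\big((r^{(c_{i,j})})_{j,i+n}-(r^{(c_{i,j})})_{j+n,i}\big)\in U(\mathfrak g)^{\otimes 2n}$ for any $\boldsymbol d\in C^n$ (the cobracket does not depend on $\boldsymbol d$). Poisson structures. A Lie cobracket $\delta$ on $\mathfrak l$ extends uniquely to a linear map $\delta:U(\mathfrak l)\to U(\mathfrak l)\otimes U(\mathfrak l)$ with $\delta(xy)=\delta(x)\Delta(y)+\Delta(x)\delta(y)$, and then $\{f,f'\}=(f\otimes f')\circ\delta$ is a Poisson bracket on the algebra $U(\mathfrak l)^*$ (with convolution product). For an algebraic group $L$ with Lie algebra $\mathfrak l$, $\Bbbk[L]$ is identified with a subalgebra of $U(\mathfrak l)^*$ via $f\mapsto(u\mapsto(u\triangleright f)(1_L))$, where $(x\triangleright f)(g)=\frac{d}{dt}\big|_{t=0}f(g\exp(tx))$ for $x\in\mathfrak l$. When $\delta=\delta_r$ is given by an r-matrix $r=\sum_t a_t\otimes b_t$, this bracket restricts to $\Bbbk[L]$ and is given by $\{f,f'\}=\sum_t\big((f\triangleleft a_t)(f'\triangleleft b_t)-(a_t\triangleright f)(b_t\triangleright f')\big)$, where $(f\triangleleft x)(g)=\frac{d}{dt}\big|_{t=0}f(\exp(tx)g)$. This is "the Poisson structure induced by the cobracket"; it is applied to $L=G$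 with $\delta$ and to $L=G^{\times n}$ with $\tilde\delta_{\mathbf c}$. *)

theory Defs
  imports Complex_Main "HOL-Library.Poly_Mapping" "HOL-Library.Function_Algebras" "HOL-Library.Numeral_Type"
begin

locale lie_algebra = vector_space sc
  for sc :: "'k::field_char_0 \<Rightarrow> 'l::ab_group_add \<Rightarrow> 'l" +
  fixes br :: "'l \<Rightarrow> 'l \<Rightarrow> 'l"
  assumes br_add_left: "br (x + y) z = br x z + br y z"
    and br_add_right: "br x (y + z) = br x y + br x z"
    and br_scale_left: "br (sc a x) y = sc a (br x y)"
    and br_scale_right: "br x (sc a y) = sc a (br x y)"
    and br_self: "br x x = 0"
    and br_jacobi: "br x (br y z) + br y (br z x) + br z (br x y) = 0"

text \<open>
  Since the scalar multiplication of a vector space is a term and not part of a type, the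
  enveloping algebra is not a type of its own. We compute with representatives:
  U(l) is the free associative algebra on the set l (the monoid algebra of the free monoid of
  words) modulo a two-sided ideal, and its tensor power with index set I is the I-fold tensor power
  of the free algebra (the monoid algebra of I-tuples of words, the tuple w standing for the
  pure tensor of the words w i) modulo the ideal generated by the relations of U(l) in each
  tensor factor. Equality in the tensor power of U(l) is the congruence \<open>env_eq\<close> below.
  The index set is a type; for two and three factors it is 2 or 3, with
  elements written 1, 2 and 1, 2, 3 (in the numeral types, 2 = 0 resp. 3 = 0).
\<close>

datatype 'l monomial = Monomial (letters: "'l list")

instantiation monomial :: (type) monoid_add
begin
definition "0 = Monomial []"
definition "u + v = Monomial (letters u @ letters v)"
instance
  by standard (auto simp: zero_monomial_def plus_monomial_def)
end

type_synonym ('k, 'l) env = "'l monomial \<Rightarrow>\<^sub>0 'k"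
type_synonym ('k, 'l, 'i) env_power = "('i \<Rightarrow> 'l monomial) \<Rightarrow>\<^sub>0 'k"

abbreviation scalar :: "'k \<Rightarrow> ('x::zero \<Rightarrow>\<^sub>0 'k::zero)" where
  "scalar a \<equiv> Poly_Mapping.single 0 a"

definition emb :: "'i \<Rightarrow> 'l \<Rightarrow> ('k::field_char_0, 'l, 'i) env_power" where
  "emb i x = Poly_Mapping.single ((\<lambda>_. 0)(i := Monomial [x])) 1"

inductive_set two_sided_ideal :: "'a::ring_1 set \<Rightarrow> 'a set" for R where
  zero: "0 \<in> two_sided_ideal R"
| add: "a \<in> two_sided_ideal R \<Longrightarrow> b \<in> two_sided_ideal R \<Longrightarrow> a + b \<in> two_sided_ideal R"
| gen: "a \<in> R \<Longrightarrow> u * a * v \<in> two_sided_ideal R"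

definition env_relations ::
  "('k::field_char_0 \<Rightarrow> 'l::ab_group_add \<Rightarrow> 'l) \<Rightarrow> ('l \<Rightarrow> 'l \<Rightarrow> 'l) \<Rightarrow> ('k, 'l, 'i) env_power set" where
  "env_relations sc br =
     {emb i (x + y) - emb i x - emb i y | i x y. True} \<union>
     {emb i (sc a x) - scalar a * emb i x | i a x. True} \<union>
     {emb i x * emb i y - emb i y * emb i x - emb i (br x y) | i x y. True}"

definition env_eq ::
  "('k::field_char_0 \<Rightarrow> 'l::ab_group_add \<Rightarrow> 'l) \<Rightarrow> ('l \<Rightarrow> 'l \<Rightarrow> 'l) \<Rightarrow>
   ('k, 'l, 'i) env_power \<Rightarrow> ('k, 'l, 'i) env_power \<Rightarrow> bool" where
  "env_eq sc br p q \<longleftrightarrow> p - q \<in> two_sided_ideal (env_relations sc br)"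

definition commutator :: "'a::ring \<Rightarrow> 'a \<Rightarrow> 'a" where
  "commutator p q = p * q - q * p"

text \<open>Linear extension of a map given on monomials, with values in monomials resp. scalars.\<close>

definition push :: "('x \<Rightarrow> 'y) \<Rightarrow> ('x \<Rightarrow>\<^sub>0 'k) \<Rightarrow> ('y \<Rightarrow>\<^sub>0 'k::field_char_0)" where
  "push h p = (\<Sum>w\<in>Poly_Mapping.keys p. Poly_Mapping.single (h w) (Poly_Mapping.lookup p w))"

definition lin :: "('x \<Rightarrow> 'k) \<Rightarrow> ('x \<Rightarrow>\<^sub>0 'k) \<Rightarrow> 'k::field_char_0" where
  "lin h p = (\<Sum>w\<in>Poly_Mapping.keys p. Poly_Mapping.lookup p w * h w)"

text \<open>\<open>place i j x\<close> is the element usually written with subscripts i, j (for distinct i, j).\<close>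

definition place :: "'i \<Rightarrow> 'i \<Rightarrow> ('k::field_char_0, 'l, 2) env_power \<Rightarrow> ('k, 'l, 'i) env_power" where
  "place i j = push (\<lambda>w. (\<lambda>_. 0)(i := w 1, j := w 2))"

definition swap :: "'i \<Rightarrow> 'i \<Rightarrow> ('k::field_char_0, 'l, 'i) env_power \<Rightarrow> ('k, 'l, 'i) env_power" where
  "swap i j = push (\<lambda>w. w(i := w j, j := w i))"

definition pure_sum :: "('l \<times> 'l) list \<Rightarrow> ('k::field_char_0, 'l, 2) env_power" where
  "pure_sum ts = (\<Sum>(a, b)\<leftarrow>ts. emb 1 a * emb 2 b)"

definition in_lie_square ::
  "('k::field_char_0 \<Rightarrow> 'l::ab_group_add \<Rightarrow> 'l) \<Rightarrow> ('l \<Rightarrow> 'l \<Rightarrow> 'l) \<Rightarrow> ('k, 'l, 2) env_power \<Rightarrow> bool" where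
  "in_lie_square sc br p \<longleftrightarrow> (\<exists>ts. env_eq sc br p (pure_sum ts))"

definition coprod :: "'l \<Rightarrow> ('k::field_char_0, 'l, 2) env_power" where
  "coprod x = emb 1 x + emb 2 x"

definition cobracket_id ::
  "('l \<Rightarrow> ('k::field_char_0, 'l, 2) env_power) \<Rightarrow> ('l \<times> 'l) list \<Rightarrow> ('k, 'l, 3) env_power" where
  "cobracket_id \<delta> ts = (\<Sum>(a, b)\<leftarrow>ts. place 1 2 (\<delta> a) * emb 3 b)"

locale lie_bialgebra = lie_algebra sc br
  for sc :: "'k::field_char_0 \<Rightarrow> 'l::ab_group_add \<Rightarrow> 'l" and br +
  fixes \<delta> :: "'l \<Rightarrow> ('k, 'l, 2) env_power"
  assumes in_square: "in_lie_square sc br (\<delta> x)"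
    and add: "env_eq sc br (\<delta> (x + y)) (\<delta> x + \<delta> y)"
    and scale: "env_eq sc br (\<delta> (sc a x)) (scalar a * \<delta> x)"
    and cocycle: "env_eq sc br (\<delta> (br x y))
       (commutator (\<delta> x) (coprod y) - commutator (\<delta> y) (coprod x))"
    and skew: "env_eq sc br (swap 1 2 (\<delta> x)) (- \<delta> x)"
    and co_jacobi: "env_eq sc br (\<delta> x) (pure_sum ts) \<Longrightarrow>
       env_eq sc br
         (cobracket_id \<delta> ts + swap 1 2 (swap 2 3 (cobracket_id \<delta> ts))
            + swap 2 3 (swap 1 2 (cobracket_id \<delta> ts))) 0"

definition r_matrix ::
  "('k::field_char_0 \<Rightarrow> 'l::ab_group_add \<Rightarrow> 'l) \<Rightarrow> ('l \<Rightarrow> 'l \<Rightarrow> 'l) \<Rightarrow>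
   ('l \<Rightarrow> ('k, 'l, 2) env_power) \<Rightarrow> ('k, 'l, 2) env_power \<Rightarrow> bool" where
  "r_matrix sc br \<delta> r \<longleftrightarrow>
     in_lie_square sc br r \<and>
     (\<forall>x. env_eq sc br (\<delta> x) (commutator r (coprod x))) \<and>
     env_eq sc br
       (commutator (place 1 2 r) (place 1 3 r) + commutator (place 1 2 r) (place 2 3 r)
          + commutator (place 1 3 r) (place 2 3 r)) (0 :: ('k, 'l, 3) env_power)"

definition transitive_array :: "('n::linorder \<Rightarrow> 'n \<Rightarrow> 'c) \<Rightarrow> bool" where
  "transitive_array c \<longleftrightarrow> (\<forall>i j k. i < j \<and> j < k \<longrightarrow> c i k \<in> {c i j, c j k})"

text \<open>The 2n tensor factors are indexed by \<open>'n + 'n\<close>: \<open>Inl i\<close> is factor i and \<open>Inr i\<close> is factor i + n.\<close>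

definition array_r ::
  "('c \<Rightarrow> ('k::field_char_0, 'l, 2) env_power) \<Rightarrow> ('n::{finite,linorder} \<Rightarrow> 'n \<Rightarrow> 'c) \<Rightarrow> ('n \<Rightarrow> 'c) \<Rightarrow>
   ('k, 'l, 'n + 'n) env_power" where
  "array_r r c d =
     (\<Sum>i\<in>UNIV. place (Inl i) (Inr i) (r (d i))) +
     (\<Sum>(i, j)\<in>{(i, j). i < j}.
        place (Inl j) (Inr i) (r (c i j)) - place (Inr j) (Inl i) (r (c i j)))"

text \<open>
  The direct sum of n copies of g is the type \<open>'n \<Rightarrow> 'g\<close>. \<open>regroup\<close> is the canonical isomorphism
  from the 2n-th tensor power of U(g) to the tensor square of the enveloping algebra of this direct
  sum. The words in the n factors of each half are concatenated in increasing order of their index;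
  as letters from different summands commute modulo the relations, the order does not matter.
\<close>

definition regroup ::
  "('k::field_char_0, 'l::zero, 'n::{finite,linorder} + 'n) env_power \<Rightarrow> ('k, 'n \<Rightarrow> 'l, 2) env_power" where
  "regroup = push (\<lambda>w s. \<Sum>i\<leftarrow>sorted_list_of_set UNIV.
     map_monomial (\<lambda>x. (\<lambda>_. 0)(i := x)) (w (if s = 1 then Inl i else Inr i)))"

definition array_cobracket ::
  "('c \<Rightarrow> ('k::field_char_0, 'l::zero, 2) env_power) \<Rightarrow> ('n::{finite,linorder} \<Rightarrow> 'n \<Rightarrow> 'c) \<Rightarrow> ('n \<Rightarrow> 'c) \<Rightarrow>
   ('n \<Rightarrow> 'l) \<Rightarrow> ('k, 'n \<Rightarrow> 'l, 2) env_power" where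
  "array_cobracket r c d x = commutator (regroup (array_r r c d)) (coprod x)"

definition function_subalgebra :: "('p \<Rightarrow> 'k::field_char_0) set \<Rightarrow> bool" where
  "function_subalgebra A \<longleftrightarrow>
     (\<forall>a. (\<lambda>_. a) \<in> A) \<and> (\<forall>f\<in>A. \<forall>g\<in>A. f + g \<in> A) \<and> (\<forall>f\<in>A. \<forall>g\<in>A. f * g \<in> A)"

text \<open>
  An affine algebraic group, given by its group of points \<open>'p\<close> and its algebra A of regular
  functions. The assumption \<open>points\<close> says that the points are exactly the \<open>'k\<close>-algebra homomorphisms
  from A to \<open>'k\<close>.
\<close>

locale algebraic_group = group mult one inv
  for mult :: "'p \<Rightarrow> 'p \<Rightarrow> 'p" and one inv +
  fixes A :: "('p \<Rightarrow> 'k::field_char_0) set"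
  assumes subalgebra: "function_subalgebra A"
    and finitely_generated:
      "\<exists>S. finite S \<and> S \<subseteq> A \<and> (\<forall>B. function_subalgebra B \<and> S \<subseteq> B \<longrightarrow> A \<subseteq> B)"
    and points: "\<lbrakk>\<And>a. \<chi> (\<lambda>_. a) = a; \<And>f g. f \<in> A \<Longrightarrow> g \<in> A \<Longrightarrow> \<chi> (f + g) = \<chi> f + \<chi> g;
       \<And>f g. f \<in> A \<Longrightarrow> g \<in> A \<Longrightarrow> \<chi> (f * g) = \<chi> f * \<chi> g\<rbrakk> \<Longrightarrow> \<exists>!p. \<forall>f\<in>A. \<chi> f = f p"
    and mult_regular:
      "f \<in> A \<Longrightarrow> \<exists>ts. set ts \<subseteq> A \<times> A \<and> (\<forall>g h. f (mult g h) = (\<Sum>(a, b)\<leftarrow>ts. a g * b h))"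
    and inv_regular: "f \<in> A \<Longrightarrow> (\<lambda>g. f (inv g)) \<in> A"

definition point_derivation :: "'p \<Rightarrow> ('p \<Rightarrow> 'k::field_char_0) set \<Rightarrow> (('p \<Rightarrow> 'k) \<Rightarrow> 'k) \<Rightarrow> bool" where
  "point_derivation p A D \<longleftrightarrow>
     (\<forall>f\<in>A. \<forall>g\<in>A. D (f + g) = D f + D g) \<and>
     (\<forall>a. \<forall>f\<in>A. D (\<lambda>g. a * f g) = a * D f) \<and>
     (\<forall>f\<in>A. \<forall>g\<in>A. D (f * g) = D f * g p + f p * D g)"

text \<open>
  A map D from l to the derivations at the identity encodes the one-parameter subgroups:
  \<open>D x f\<close> is the derivative at t = 0 of f (exp (t x)). The action of x on regular
  functions sends f to the function whose value at g is the derivative of f (g exp (t x)).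
\<close>

definition act ::
  "('p \<Rightarrow> 'p \<Rightarrow> 'p) \<Rightarrow> ('l \<Rightarrow> ('p \<Rightarrow> 'k) \<Rightarrow> 'k) \<Rightarrow> 'l \<Rightarrow> ('p \<Rightarrow> 'k) \<Rightarrow> ('p \<Rightarrow> 'k)" where
  "act mult D x f = (\<lambda>g. D x (\<lambda>h. f (mult g h)))"

text \<open>D identifies l, as a Lie algebra, with the Lie algebra of the group.\<close>

definition lie_algebra_of_group ::
  "('p \<Rightarrow> 'p \<Rightarrow> 'p) \<Rightarrow> 'p \<Rightarrow> ('p \<Rightarrow> 'k::field_char_0) set \<Rightarrow>
   ('k \<Rightarrow> 'l::ab_group_add \<Rightarrow> 'l) \<Rightarrow> ('l \<Rightarrow> 'l \<Rightarrow> 'l) \<Rightarrow> ('l \<Rightarrow> ('p \<Rightarrow> 'k) \<Rightarrow> 'k) \<Rightarrow> bool" where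
  "lie_algebra_of_group mult one A sc br D \<longleftrightarrow>
     (\<forall>x y. \<forall>f\<in>A. D (x + y) f = D x f + D y f) \<and>
     (\<forall>a x. \<forall>f\<in>A. D (sc a x) f = a * D x f) \<and>
     (\<forall>x. point_derivation one A (D x)) \<and>
     (\<forall>E. point_derivation one A E \<longrightarrow> (\<exists>!x. \<forall>f\<in>A. D x f = E f)) \<and>
     (\<forall>x y. \<forall>f\<in>A. D (br x y) f = D x (act mult D y f) - D y (act mult D x f))"

text \<open>The functional on U(l) given by a regular function f: it sends u to the value of u acting on f
  at the identity. The coordinate ring A of a connected group is regarded as a subalgebra of the dual
  of U(l) via this map; injectivity on A is what makes this an identification.\<close>

definition to_dual ::
  "('p \<Rightarrow> 'p \<Rightarrow> 'p) \<Rightarrow> 'p \<Rightarrow> ('l \<Rightarrow> ('p \<Rightarrow> 'k) \<Rightarrow> 'k) \<Rightarrow> ('p \<Rightarrow> 'k::field_char_0) \<Rightarrow> ('k, 'l) env \<Rightarrow> 'k" where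
  "to_dual mult one D f = lin (\<lambda>w. foldr (act mult D) (letters w) f one)"

text \<open>The tensor power of A consists of the sums of products of functions in A of the
  separate coordinates; on functions on the direct power, the multiplication map of the tensor power
  becomes restriction to the diagonal.\<close>

definition power_mult :: "('p \<Rightarrow> 'p \<Rightarrow> 'p) \<Rightarrow> ('n \<Rightarrow> 'p) \<Rightarrow> ('n \<Rightarrow> 'p) \<Rightarrow> ('n \<Rightarrow> 'p)" where
  "power_mult mult g h = (\<lambda>i. mult (g i) (h i))"

definition power_functions :: "('p \<Rightarrow> 'k::field_char_0) set \<Rightarrow> (('n::finite \<Rightarrow> 'p) \<Rightarrow> 'k) set" where
  "power_functions A =
     module.span (\<lambda>a F g. a * F g) {\<lambda>g. \<Prod>i\<in>UNIV. f i (g i) | f. \<forall>i. f i \<in> A}"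

definition power_derivation ::
  "'p \<Rightarrow> ('l \<Rightarrow> ('p \<Rightarrow> 'k) \<Rightarrow> 'k) \<Rightarrow> ('n::finite \<Rightarrow> 'l) \<Rightarrow> (('n \<Rightarrow> 'p) \<Rightarrow> 'k::field_char_0) \<Rightarrow> 'k" where
  "power_derivation one D x F = (\<Sum>i\<in>UNIV. D (x i) (\<lambda>h. F ((\<lambda>_. one)(i := h))))"

definition poisson_algebra ::
  "('p \<Rightarrow> 'k::field_char_0) set \<Rightarrow> (('p \<Rightarrow> 'k) \<Rightarrow> ('p \<Rightarrow> 'k) \<Rightarrow> ('p \<Rightarrow> 'k)) \<Rightarrow> bool" where
  "poisson_algebra A pb \<longleftrightarrow>
     function_subalgebra A \<and>
     (\<forall>f\<in>A. \<forall>g\<in>A. pb f g \<in> A) \<and>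
     (\<forall>f\<in>A. \<forall>g\<in>A. \<forall>h\<in>A. pb (f + g) h = pb f h + pb g h \<and> pb h (f + g) = pb h f + pb h g) \<and>
     (\<forall>a. \<forall>f\<in>A. \<forall>g\<in>A. pb ((\<lambda>_. a) * f) g = (\<lambda>_. a) * pb f g \<and> pb f ((\<lambda>_. a) * g) = (\<lambda>_. a) * pb f g) \<and>
     (\<forall>f\<in>A. pb f f = 0) \<and>
     (\<forall>f\<in>A. \<forall>g\<in>A. \<forall>h\<in>A. pb f (pb g h) + pb g (pb h f) + pb h (pb f g) = 0) \<and>
     (\<forall>f\<in>A. \<forall>g\<in>A. \<forall>h\<in>A. pb f (g * h) = pb f g * h + g * pb f h)"

definition poisson_hom ::
  "('p \<Rightarrow> 'k::field_char_0) set \<Rightarrow> (('p \<Rightarrow> 'k) \<Rightarrow> ('p \<Rightarrow> 'k) \<Rightarrow> ('p \<Rightarrow> 'k)) \<Rightarrow>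
   ('q \<Rightarrow> 'k) set \<Rightarrow> (('q \<Rightarrow> 'k) \<Rightarrow> ('q \<Rightarrow> 'k) \<Rightarrow> ('q \<Rightarrow> 'k)) \<Rightarrow>
   (('p \<Rightarrow> 'k) \<Rightarrow> ('q \<Rightarrow> 'k)) \<Rightarrow> bool" where
  "poisson_hom A pbA B pbB \<phi> \<longleftrightarrow>
     poisson_algebra A pbA \<and> poisson_algebra B pbB \<and>
     (\<forall>f\<in>A. \<phi> f \<in> B) \<and>
     (\<forall>a. \<phi> (\<lambda>_. a) = (\<lambda>_. a)) \<and>
     (\<forall>f\<in>A. \<forall>g\<in>A. \<phi> (f + g) = \<phi> f + \<phi> g) \<and>
     (\<forall>f\<in>A. \<forall>g\<in>A. \<phi> (f * g) = \<phi> f * \<phi> g) \<and>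
     (\<forall>f\<in>A. \<forall>g\<in>A. \<phi> (pbA f g) = pbB (\<phi> f) (\<phi> g))"

text \<open>The extension of a cobracket to U(l), determined by the product rule
  \<open>\<delta>(x w) = \<delta>(x) \<Delta>(w) + \<Delta>(x) \<delta>(w)\<close> (which forces \<open>\<delta>(1) = 0\<close>).\<close>

primrec cobracket_word ::
  "('l \<Rightarrow> ('k::field_char_0, 'l, 2) env_power) \<Rightarrow> 'l list \<Rightarrow> ('k, 'l, 2) env_power" where
  "cobracket_word \<delta> [] = 0"
| "cobracket_word \<delta> (x # xs) = \<delta> x * prod_list (map coprod xs) + coprod x * cobracket_word \<delta> xs"

definition cobracket_ext ::
  "('l \<Rightarrow> ('k::field_char_0, 'l, 2) env_power) \<Rightarrow> ('k, 'l) env \<Rightarrow> ('k, 'l, 2) env_power" where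
  "cobracket_ext \<delta> u =
     (\<Sum>w\<in>Poly_Mapping.keys u. scalar (Poly_Mapping.lookup u w) * cobracket_word \<delta> (letters w))"

definition dual_bracket ::
  "('l \<Rightarrow> ('k::field_char_0, 'l, 2) env_power) \<Rightarrow>
   (('k, 'l) env \<Rightarrow> 'k) \<Rightarrow> (('k, 'l) env \<Rightarrow> 'k) \<Rightarrow> ('k, 'l) env \<Rightarrow> 'k" where
  "dual_bracket \<delta> \<phi> \<psi> u =
     lin (\<lambda>w. \<phi> (Poly_Mapping.single (w 1) 1) * \<psi> (Poly_Mapping.single (w 2) 1)) (cobracket_ext \<delta> u)"

text \<open>The restriction of \<open>dual_bracket\<close> to A, regarded as a subspace of the dual of U(l) via
  \<open>to_dual\<close>; meaningful when \<open>to_dual\<close> is injective on A and the bracket restricts to its image.\<close>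

definition induced_bracket ::
  "('p \<Rightarrow> 'p \<Rightarrow> 'p) \<Rightarrow> 'p \<Rightarrow> ('p \<Rightarrow> 'k::field_char_0) set \<Rightarrow> ('l \<Rightarrow> ('p \<Rightarrow> 'k) \<Rightarrow> 'k) \<Rightarrow>
   ('l \<Rightarrow> ('k, 'l, 2) env_power) \<Rightarrow> ('p \<Rightarrow> 'k) \<Rightarrow> ('p \<Rightarrow> 'k) \<Rightarrow> ('p \<Rightarrow> 'k)" where
  "induced_bracket mult one A D \<delta> f g =
     (THE h. h \<in> A \<and>
        to_dual mult one D h = dual_bracket \<delta> (to_dual mult one D f) (to_dual mult one D g))"

end

theory Submission
  imports Defs
begin

text \<open>
  For an r-matrix r inducing the cobracket, \<open>\<delta>(u) = [r, \<Delta>(u)]\<close> on the enveloping algebra, so the dual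
  bracket of f and g is the regular function
  \<open>\<Sum> (R a f) (R b g) - (L a f) (L b g)\<close>, summed over the terms \<open>a \<otimes> b\<close> of r, with L and R the left and right
  infinitesimal translations. Its Jacobiator is the functional given by cyclic permutations of
  \<open>[r23, [r12 + r13, \<Delta>(u)]]\<close>, which is \<open>- [CYB(r), \<Delta>(u)]\<close> up to terms that vanish because
  \<open>r + r21\<close> commutes with the image of \<open>\<Delta>\<close>.

  On the power of g the r-matrix has blocks r(a, b), each equal to some \<open>r\<^sup>c\<close> or to some \<open>- r\<^sup>c\<close> flipped; all of them
  induce \<open>\<delta>\<close>, so any two differ by an invariant element. Up to commutators with invariant elements the
  component (a, b, c) of the Yang-Baxter equation is that of a single block as soon as r(a, c) equals r(a, b) or
  r(b, c), or r(a, b) is minus the flip of r(b, c); transitivity of the array gives one of these cases.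
  Finally each block induces \<open>\<delta>\<close> on the diagonal, so the cobracket restricted to the diagonal subalgebra is the diagonal
  image of \<open>\<delta>\<close>, which dually says that restriction of functions to the diagonal is Poisson.
\<close>

section \<open>Monoid algebras and tensor powers of the enveloping algebra\<close>

text \<open>Identities of regular functions are proved by pairing. \<open>evl\<close> pairs a family
  of functions with a representative in a tensor power of the enveloping algebra: letters multiplied
  on the right act by \<open>L\<close>, letters multiplied on the left act by \<open>R\<close>, and
  the defining relations pair to zero. Injectivity of \<open>to_dual\<close> says that a regular
  function is determined by its pairings with words, so skewness, the Jacobi identity and
  compatibility with the diagonal all reduce to congruences \<open>env_eq\<close> between explicit
  representatives, and no basis of the enveloping algebra enters. The price is that injectivity has
  to be established for the power of the group as well; it is inherited from the factor. The
  obstacle on the power is that three different blocks meet in one component of the Yang-Baxter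
  equation, while the hypotheses speak of one r-matrix at a time. What makes an exchange of blocks
  possible is that an invariant element in two tensor factors commutes with any r one of whose legs
  is spread over these two factors by the coproduct.\<close>

lemma poly_mapping_induct_single [case_names single add]:
  assumes single: "\<And>w a. P (Poly_Mapping.single w a)" and add: "\<And>p q. P p \<Longrightarrow> P q \<Longrightarrow> P (p + q)"
  shows "P (p :: 'x \<Rightarrow>\<^sub>0 'k::comm_monoid_add)"
proof -
  have zero: "P 0" using single[of undefined 0] by simp
  have "finite S \<Longrightarrow> P (\<Sum>w\<in>S. Poly_Mapping.single w (Poly_Mapping.lookup p w))" for S
    by (induction S rule: finite_induct) (auto intro: single add zero)
  then have "P (\<Sum>w\<in>Poly_Mapping.keys p. Poly_Mapping.single w (Poly_Mapping.lookup p w))" by simp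
  also have "(\<Sum>w\<in>Poly_Mapping.keys p. Poly_Mapping.single w (Poly_Mapping.lookup p w)) = p"
    by (rule poly_mapping_eqI)
      (simp add: lookup_sum lookup_single when_def sum.delta' in_keys_iff cong: if_cong)
  finally show ?thesis .
qed

text \<open>Cancellation can make the support of a sum smaller than the union of the supports, so
  additivity is proved over a common finite superset.\<close>

lemma lin_superset:
  assumes "finite S" "Poly_Mapping.keys p \<subseteq> S"
  shows "lin h p = (\<Sum>w\<in>S. Poly_Mapping.lookup p w * h w)"
  unfolding lin_def by (rule sum.mono_neutral_left) (use assms in \<open>auto simp: in_keys_iff\<close>)

lemma lin_single [simp]: "lin h (Poly_Mapping.single w a) = a * h w"
  by (subst lin_superset[of "{w}"]) auto

lemma lin_add: "lin h (p + q) = lin h p + lin h q"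
proof -
  let ?S = "Poly_Mapping.keys p \<union> Poly_Mapping.keys q"
  have "lin h (p + q) = (\<Sum>w\<in>?S. Poly_Mapping.lookup (p + q) w * h w)"
    by (rule lin_superset) (auto simp: in_keys_iff lookup_add)
  also have "\<dots> = (\<Sum>w\<in>?S. Poly_Mapping.lookup p w * h w) + (\<Sum>w\<in>?S. Poly_Mapping.lookup q w * h w)"
    by (simp add: lookup_add algebra_simps sum.distrib)
  also have "\<dots> = lin h p + lin h q" by (simp add: lin_superset[of ?S])
  finally show ?thesis .
qed

lemma lin_zero [simp]: "lin h 0 = 0" by (simp add: lin_def)

lemma lin_minus: "lin h (- p) = - lin h p"
  using lin_add[of h p "- p"] by (simp add: add_eq_0_iff)

lemma lin_diff: "lin h (p - q) = lin h p - lin h q"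
  using lin_add[of h p "- q"] by (simp add: lin_minus)

lemma lin_sum: "lin h (\<Sum>x\<in>S. f x) = (\<Sum>x\<in>S. lin h (f x))"
  by (induction S rule: infinite_finite_induct) (auto simp: lin_add)

lemma lin_sum_list: "lin h (\<Sum>x\<leftarrow>xs. f x) = (\<Sum>x\<leftarrow>xs. lin h (f x))"
  by (induction xs) (auto simp: lin_add)

lemma lin_scalar: "lin h (scalar a * p) = a * lin h (p :: 'x::monoid_add \<Rightarrow>\<^sub>0 'k::field_char_0)"
  by (induction p rule: poly_mapping_induct_single)
    (auto simp: mult_single distrib_left lin_add algebra_simps)

lemma push_superset:
  assumes "finite S" "Poly_Mapping.keys p \<subseteq> S"
  shows "push h p = (\<Sum>w\<in>S. Poly_Mapping.single (h w) (Poly_Mapping.lookup p w))"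
  unfolding push_def by (rule sum.mono_neutral_left) (use assms in \<open>auto simp: in_keys_iff\<close>)

lemma push_single [simp]: "push h (Poly_Mapping.single w a) = Poly_Mapping.single (h w) a"
  by (subst push_superset[of "{w}"]) auto

lemma push_add: "push h (p + q) = push h p + push h q"
proof -
  let ?S = "Poly_Mapping.keys p \<union> Poly_Mapping.keys q"
  have "push h (p + q) = (\<Sum>w\<in>?S. Poly_Mapping.single (h w) (Poly_Mapping.lookup (p + q) w))"
    by (rule push_superset) (auto simp: in_keys_iff lookup_add)
  also have "\<dots> = (\<Sum>w\<in>?S. Poly_Mapping.single (h w) (Poly_Mapping.lookup p w)) + (\<Sum>w\<in>?S. Poly_Mapping.single (h w) (Poly_Mapping.lookup q w))"
    by (simp add: lookup_add single_add sum.distrib)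
  also have "\<dots> = push h p + push h q" by (simp add: push_superset[of ?S])
  finally show ?thesis .
qed

lemma push_zero [simp]: "push h 0 = 0" by (simp add: push_def)

lemma push_minus: "push h (- p) = - push h p"
  using push_add[of h p "- p"] by (simp add: add_eq_0_iff)

lemma push_diff: "push h (p - q) = push h p - push h q"
  using push_add[of h p "- q"] by (simp add: push_minus)

lemma push_sum: "push h (\<Sum>x\<in>S. f x) = (\<Sum>x\<in>S. push h (f x))"
  by (induction S rule: infinite_finite_induct) (auto simp: push_add)

lemma push_mult:
  fixes p q :: "'x::monoid_add \<Rightarrow>\<^sub>0 'k::field_char_0" and h :: "'x \<Rightarrow> 'y::monoid_add"
  assumes h: "\<And>u v. h (u + v) = h u + h v"
  shows "push h (p * q) = push h p * push h q"
proof (induction p rule: poly_mapping_induct_single)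
  case (single u a)
  show ?case
    by (induction q rule: poly_mapping_induct_single)
      (auto simp: mult_single h distrib_left push_add)
qed (simp add: distrib_right push_add)

lemma push_push: "push h (push h' p) = push (\<lambda>w. h (h' w)) p"
  by (induction p rule: poly_mapping_induct_single) (auto simp: push_add)

lemma lin_push: "lin \<phi> (push h p) = lin (\<lambda>w. \<phi> (h w)) p"
  by (induction p rule: poly_mapping_induct_single) (auto simp: push_add lin_add)

section \<open>Congruence modulo the relations of the enveloping algebra\<close>

lemma two_sided_ideal_minus: "p \<in> two_sided_ideal R \<Longrightarrow> - p \<in> two_sided_ideal R"
proof (induction rule: two_sided_ideal.induct)
  case (gen a u v)
  then show ?case using two_sided_ideal.gen[of a R "- u" v] by simp
next
  case (add a b)
  then show ?case using two_sided_ideal.add[of "- a" R "- b"] by simp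
qed (auto intro: two_sided_ideal.intros)

lemma two_sided_ideal_diff:
  "p \<in> two_sided_ideal R \<Longrightarrow> q \<in> two_sided_ideal R \<Longrightarrow> p - q \<in> two_sided_ideal R"
  using two_sided_ideal.add[of p R "- q"] two_sided_ideal_minus[of q R] by simp

lemma two_sided_ideal_mult_left: "p \<in> two_sided_ideal R \<Longrightarrow> c * p \<in> two_sided_ideal R"
proof (induction rule: two_sided_ideal.induct)
  case (gen a u v)
  then show ?case using two_sided_ideal.gen[of a R "c * u" v] by (simp add: mult.assoc)
qed (auto intro: two_sided_ideal.intros simp: distrib_left)

lemma two_sided_ideal_mult_right: "p \<in> two_sided_ideal R \<Longrightarrow> p * c \<in> two_sided_ideal R"
proof (induction rule: two_sided_ideal.induct)
  case (gen a u v)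
  then show ?case using two_sided_ideal.gen[of a R u "v * c"] by (simp add: mult.assoc)
qed (auto intro: two_sided_ideal.intros simp: distrib_right)

lemma two_sided_ideal_gen: "p \<in> R \<Longrightarrow> p \<in> two_sided_ideal R"
  using two_sided_ideal.gen[of p R 1 1] by simp

lemma two_sided_ideal_hom:
  assumes add: "\<And>p q. f (p + q) = f p + f q" and mult: "\<And>p q. f (p * q) = f p * f q"
    and rel: "\<And>a. a \<in> R \<Longrightarrow> f a \<in> two_sided_ideal R'"
    and "p \<in> two_sided_ideal R"
  shows "f p \<in> two_sided_ideal R'"
  using assms(4)
proof (induction rule: two_sided_ideal.induct)
  case zero
  have "f 0 = 0" using add[of 0 0] by simp
  then show ?case by (simp add: two_sided_ideal.zero)
next
  case (gen a u v)
  then show ?case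
    by (simp add: mult rel two_sided_ideal_mult_left two_sided_ideal_mult_right)
qed (auto simp: add intro: two_sided_ideal.intros)

lemma env_eq_refl [simp, intro]: "env_eq sc br p p"
  by (simp add: env_eq_def two_sided_ideal.zero)

lemma env_eq_sym: "env_eq sc br p q \<Longrightarrow> env_eq sc br q p"
  unfolding env_eq_def using two_sided_ideal_minus by fastforce

lemma env_eq_trans [trans]: "env_eq sc br p q \<Longrightarrow> env_eq sc br q s \<Longrightarrow> env_eq sc br p s"
  unfolding env_eq_def using two_sided_ideal.add[of "p - q" _ "q - s"] by simp

lemma env_eq_add: "env_eq sc br p p' \<Longrightarrow> env_eq sc br q q' \<Longrightarrow> env_eq sc br (p + q) (p' + q')"
  unfolding env_eq_def using two_sided_ideal.add[of "p - p'" _ "q - q'"]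
  by (simp add: algebra_simps)

lemma env_eq_diff: "env_eq sc br p p' \<Longrightarrow> env_eq sc br q q' \<Longrightarrow> env_eq sc br (p - q) (p' - q')"
  unfolding env_eq_def using two_sided_ideal_diff[of "p - p'" _ "q - q'"]
  by (simp add: algebra_simps)

lemma env_eq_minus: "env_eq sc br p p' \<Longrightarrow> env_eq sc br (- p) (- p')"
  using env_eq_diff[of sc br 0 0 p p'] by simp

lemma env_eq_mult:
  assumes "env_eq sc br p p'" "env_eq sc br q q'"
  shows "env_eq sc br (p * q) (p' * q')"
proof -
  have "p * q - p' * q' = (p - p') * q + p' * (q - q')" by (simp add: algebra_simps)
  then show ?thesis using assms unfolding env_eq_def
    by (simp add: two_sided_ideal.add two_sided_ideal_mult_left two_sided_ideal_mult_right)
qed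

lemma env_eq_sum:
  "(\<And>x. x \<in> S \<Longrightarrow> env_eq sc br (f x) (g x)) \<Longrightarrow> env_eq sc br (\<Sum>x\<in>S. f x) (\<Sum>x\<in>S. g x)"
  by (induction S rule: infinite_finite_induct) (auto intro: env_eq_add)

lemma env_eq_sum_list:
  "(\<And>x. x \<in> set xs \<Longrightarrow> env_eq sc br (f x) (g x)) \<Longrightarrow> env_eq sc br (\<Sum>x\<leftarrow>xs. f x) (\<Sum>x\<leftarrow>xs. g x)"
  by (induction xs) (auto intro: env_eq_add)

lemma env_eq_commutator:
  "env_eq sc br p p' \<Longrightarrow> env_eq sc br q q' \<Longrightarrow> env_eq sc br (commutator p q) (commutator p' q')"
  unfolding commutator_def by (intro env_eq_diff env_eq_mult)

text \<open>Passage to the quotients: additivity and multiplicativity take care of the ideal, so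
  only the defining relations have to be checked.\<close>

lemma env_eq_hom:
  assumes add: "\<And>p q. f (p + q) = f p + f q" and mult: "\<And>p q. f (p * q) = f p * f q"
    and rel: "\<And>a. a \<in> env_relations sc br \<Longrightarrow> env_eq sc' br' (f a) 0"
    and pq: "env_eq sc br p q"
  shows "env_eq sc' br' (f p) (f q)"
proof -
  have "f (p - q) \<in> two_sided_ideal (env_relations sc' br')"
    by (rule two_sided_ideal_hom[of f]) (use assms in \<open>auto simp: env_eq_def\<close>)
  moreover have "f (p - q) = f p - f q"
    using add[of "p - q" q] by simp
  ultimately show ?thesis by (simp add: env_eq_def)
qed

lemma emb_add: "env_eq sc br (emb i (x + y)) (emb i x + emb i y)"
proof -
  have "emb i (x + y) - emb i x - emb i y \<in> env_relations sc br"
    unfolding env_relations_def by blast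
  then show ?thesis
    unfolding env_eq_def using two_sided_ideal_gen by (fastforce simp: diff_diff_eq)
qed

lemma emb_scale: "env_eq sc br (emb i (sc a x)) (scalar a * emb i x)"
  unfolding env_eq_def
  by (rule two_sided_ideal_gen) (unfold env_relations_def, blast)

lemma emb_bracket: "env_eq sc br (commutator (emb i x) (emb i y)) (emb i (br x y))"
  unfolding env_eq_def commutator_def
  by (rule two_sided_ideal_gen) (unfold env_relations_def, blast)

lemma emb_zero: "env_eq sc br (emb i 0) 0"
  using env_eq_diff[OF emb_add[of sc br i 0 0] env_eq_refl[of sc br "emb i 0"]]
  by (simp add: env_eq_sym)

lemma emb_sum: "env_eq sc br (emb i (\<Sum>x\<in>S. f x)) (\<Sum>x\<in>S. emb i (f x))"
proof (induction S rule: infinite_finite_induct)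
  case (insert x S)
  have "env_eq sc br (emb i (f x + sum f S)) (emb i (f x) + emb i (sum f S))" by (rule emb_add)
  also have "env_eq sc br \<dots> (emb i (f x) + (\<Sum>x\<in>S. emb i (f x)))"
    by (intro env_eq_add insert env_eq_refl)
  finally show ?case using insert by simp
qed (auto simp: emb_zero)

lemma emb_commute: "i \<noteq> j \<Longrightarrow> emb i x * emb j y = emb j y * emb i x"
  unfolding emb_def mult_single
  by (rule arg_cong[where f = "\<lambda>w. Poly_Mapping.single w _"]) (auto simp: fun_eq_iff)

lemma commutator_add_left: "commutator (p + q) s = commutator p s + commutator q s"
  and commutator_add_right: "commutator s (p + q) = commutator s p + commutator s q"
  and commutator_diff_left: "commutator (p - q) s = commutator p s - commutator q s"
  and commutator_zero_left [simp]: "commutator 0 s = 0"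
  and commutator_zero_right [simp]: "commutator s 0 = 0"
  and commutator_mult_right: "commutator s (p * q) = commutator s p * q + p * commutator s q"
  and commutator_mult_left: "commutator (p * q) s = commutator p s * q + p * commutator q s"
  by (simp_all add: commutator_def algebra_simps)

lemma commutator_sum_left: "commutator (\<Sum>x\<in>S. f x) s = (\<Sum>x\<in>S. commutator (f x) s)"
  and commutator_sum_right: "commutator s (\<Sum>x\<in>S. f x) = (\<Sum>x\<in>S. commutator s (f x))"
  by (simp_all add: commutator_def sum_distrib_left sum_distrib_right sum_subtractf)

text \<open>The commutator is a derivation in each argument, so the centralizer of an element modulo
  the relations is closed under products. Invariance can therefore be checked on letters and their
  coproducts.\<close>

lemma commutator_mult_right_null:
  assumes "env_eq sc br (commutator s p) 0" "env_eq sc br (commutator s q) 0"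
  shows "env_eq sc br (commutator s (p * q)) 0"
  using env_eq_add[OF env_eq_mult[OF assms(1) env_eq_refl[of sc br q]] env_eq_mult[OF env_eq_refl[of sc br p] assms(2)]]
  by (simp add: commutator_mult_right)

lemma commutator_mult_left_null:
  assumes "env_eq sc br (commutator p s) 0" "env_eq sc br (commutator q s) 0"
  shows "env_eq sc br (commutator (p * q) s) 0"
  using env_eq_add[OF env_eq_mult[OF assms(1) env_eq_refl[of sc br q]] env_eq_mult[OF env_eq_refl[of sc br p] assms(2)]]
  by (simp add: commutator_mult_left)

lemma commutator_prod_list_null:
  assumes "\<And>x. x \<in> set xs \<Longrightarrow> env_eq sc br (commutator s (f x)) 0"
  shows "env_eq sc br (commutator s (prod_list (map f xs))) 0"
  using assms
proof (induction xs)
  case Nil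
  then show ?case by (simp add: commutator_def)
qed (auto intro: commutator_mult_right_null)

lemma env_eq_null_add: "env_eq sc br p 0 \<Longrightarrow> env_eq sc br q 0 \<Longrightarrow> env_eq sc br (p + q) 0"
  using env_eq_add[of sc br p 0 q 0] by simp

lemma env_eq_null_sum: "(\<And>x. x \<in> S \<Longrightarrow> env_eq sc br (f x) 0) \<Longrightarrow> env_eq sc br (\<Sum>x\<in>S. f x) 0"
  using env_eq_sum[of S sc br f "\<lambda>_. 0"] by simp

lemma env_eq_iff_diff: "env_eq sc br p q \<longleftrightarrow> env_eq sc br (p - q) 0"
  by (simp add: env_eq_def)

text \<open>Sums and products over the index type can then be unfolded along the labels 1 and 2,
  although the numeral 2 denotes 0 in this type.\<close>

lemma UNIV_two: "(UNIV :: 2 set) = {1, 2}" and two_distinct [simp]: "(1::2) \<noteq> 2" "(2::2) \<noteq> 1"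
proof -
  show n: "(1::2) \<noteq> 2" "(2::2) \<noteq> 1" by simp_all
  have "card {1, 2 :: 2} = card (UNIV :: 2 set)" using n by simp
  then show "(UNIV :: 2 set) = {1, 2}" by (metis card_subset_eq finite subset_UNIV)
qed

lemma UNIV_three: "(UNIV :: 3 set) = {1, 2, 3}"
  and three_distinct [simp]: "(1::3) \<noteq> 2" "(2::3) \<noteq> 1" "(1::3) \<noteq> 3" "(3::3) \<noteq> 1" "(2::3) \<noteq> 3" "(3::3) \<noteq> 2"
proof -
  show n: "(1::3) \<noteq> 2" "(2::3) \<noteq> 1" "(1::3) \<noteq> 3" "(3::3) \<noteq> 1" "(2::3) \<noteq> 3" "(3::3) \<noteq> 2"
    by simp_all
  have "card {1, 2, 3 :: 3} = card (UNIV :: 3 set)" using n by simp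
  then show "(UNIV :: 3 set) = {1, 2, 3}" by (metis card_subset_eq finite subset_UNIV)
qed

section \<open>Lie bialgebras and the classical Yang-Baxter equation\<close>

lemma env_eq_null_minus: "env_eq sc br p 0 \<Longrightarrow> env_eq sc br (- p) 0"
  using env_eq_minus[of sc br p 0] by simp

text \<open>A list fixes one presentation of a two-leg tensor, which can then be placed in any two
  factors, moved along Lie algebra maps and fed leg by leg into functions. The order of i and j is
  free, so \<open>tens 2 1\<close> is the flip.\<close>

definition tens :: "'i \<Rightarrow> 'i \<Rightarrow> ('l \<times> 'l) list \<Rightarrow> ('k::field_char_0, 'l, 'i) env_power" where
  "tens i j ts = (\<Sum>(a, b)\<leftarrow>ts. emb i a * emb j b)"

lemma pure_sum_eq_tens: "pure_sum ts = tens 1 2 ts"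
  by (simp add: pure_sum_def tens_def)

lemma tens_simps [simp]:
  "tens i j [] = 0" "tens i j ((a, b) # ts) = emb i a * emb j b + tens i j ts"
  "tens i j (ts @ us) = tens i j ts + tens i j us"
  by (simp_all add: tens_def)

definition lie_hom ::
  "('k::field_char_0 \<Rightarrow> 'l::ab_group_add \<Rightarrow> 'l) \<Rightarrow> ('l \<Rightarrow> 'l \<Rightarrow> 'l) \<Rightarrow>
   ('k \<Rightarrow> 'm::ab_group_add \<Rightarrow> 'm) \<Rightarrow> ('m \<Rightarrow> 'm \<Rightarrow> 'm) \<Rightarrow> ('l \<Rightarrow> 'm) \<Rightarrow> bool" where
  "lie_hom sc br sc' br' h \<longleftrightarrow>
     (\<forall>x y. h (x + y) = h x + h y) \<and> (\<forall>a x. h (sc a x) = sc' a (h x)) \<and>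
     (\<forall>x y. h (br x y) = br' (h x) (h y))"

lemma lie_hom_id: "lie_hom sc br sc br (\<lambda>x. x)"
  by (simp add: lie_hom_def)

text \<open>Common source of the congruences for \<open>place\<close> and \<open>transport\<close>:
  factors are renamed by \<open>\<sigma>\<close>, letters are changed by Lie algebra maps, and each
  of the three families of relations goes to the same family.\<close>

lemma env_eq_tensor_hom:
  fixes f :: "('k::field_char_0, 'l::ab_group_add, 'i) env_power \<Rightarrow> ('k, 'm::ab_group_add, 'j) env_power"
  assumes add: "\<And>p q. f (p + q) = f p + f q" and mult: "\<And>p q. f (p * q) = f p * f q"
    and scalar: "\<And>a. f (scalar a) = scalar a" and emb: "\<And>i x. f (emb i x) = emb (\<sigma> i) (h i x)"
    and h: "\<And>i. lie_hom sc br sc' br' (h i)"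
    and pq: "env_eq sc br p q"
  shows "env_eq sc' br' (f p) (f q)"
proof (rule env_eq_hom[OF add mult _ pq])
  fix a :: "('k, 'l, 'i) env_power" assume "a \<in> env_relations sc br"
  have diff: "f (p - q) = f p - f q" for p q
    using add[of "p - q" q] by simp
  from \<open>a \<in> _\<close> consider
    i x y where "a = emb i (x + y) - emb i x - emb i y" |
    i c x where "a = emb i (sc c x) - scalar c * emb i x" |
    i x y where "a = emb i x * emb i y - emb i y * emb i x - emb i (br x y)"
    unfolding env_relations_def by blast
  then show "env_eq sc' br' (f a) 0"
  proof cases
    case (1 i x y)
    then have "f a = emb (\<sigma> i) (h i x + h i y) - (emb (\<sigma> i) (h i x) + emb (\<sigma> i) (h i y))"
      using h[of i] by (simp add: diff emb lie_hom_def)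
    then show ?thesis using emb_add[of sc' br'] env_eq_iff_diff by metis
  next
    case (2 i c x)
    then have "f a = emb (\<sigma> i) (sc' c (h i x)) - scalar c * emb (\<sigma> i) (h i x)"
      using h[of i] by (simp add: diff emb mult scalar lie_hom_def)
    then show ?thesis using emb_scale[of sc' br'] env_eq_iff_diff by metis
  next
    case (3 i x y)
    then have "f a = commutator (emb (\<sigma> i) (h i x)) (emb (\<sigma> i) (h i y)) - emb (\<sigma> i) (br' (h i x) (h i y))"
      using h[of i] by (simp add: diff emb mult lie_hom_def commutator_def)
    then show ?thesis using emb_bracket[of sc' br'] env_eq_iff_diff by metis
  qed
qed

lemma place_add: "place i j (p + q) = place i j p + place i j q"
  and place_diff: "place i j (p - q) = place i j p - place i j q"
  by (simp_all add: place_def push_add push_minus push_diff)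

lemma place_zero [simp]: "place i j 0 = 0"
  by (simp add: place_def)

lemma place_mult: "i \<noteq> j \<Longrightarrow> place i j (p * q) = place i j p * place i j q"
  unfolding place_def by (rule push_mult) (auto simp: fun_eq_iff)

lemma place_scalar [simp]: "place i j (scalar a) = scalar a"
  by (auto simp: place_def fun_eq_iff intro!: arg_cong[where f = "\<lambda>w. Poly_Mapping.single w _"])

lemma place_emb: "i \<noteq> j \<Longrightarrow> place i j (emb s x) = emb (if s = 1 then i else j) x"
  using UNIV_two
  by (auto simp: place_def emb_def fun_eq_iff intro!: arg_cong[where f = "\<lambda>w. Poly_Mapping.single w _"])

lemma place_tens: "i \<noteq> j \<Longrightarrow> place i j (tens s t ts) = tens (if s = 1 then i else j) (if t = 1 then i else j) ts"
  by (induction ts) (auto simp: place_add place_mult place_emb)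

lemma env_eq_place:
  assumes "i \<noteq> j" "env_eq sc br p q"
  shows "env_eq sc br (place i j p) (place i j q)"
  by (rule env_eq_tensor_hom[where h = "\<lambda>_ x. x" and \<sigma> = "\<lambda>s. if s = 1 then i else j" and sc = sc and br = br])
    (use assms in \<open>auto simp: place_add place_mult place_emb lie_hom_id\<close>)

lemma place_commutator: "i \<noteq> j \<Longrightarrow> place i j (commutator p q) = commutator (place i j p) (place i j q)"
  by (simp add: commutator_def place_diff place_mult)

lemma place_coprod: "i \<noteq> j \<Longrightarrow> place i j (coprod x) = emb i x + emb j x"
  by (simp add: coprod_def place_add place_emb)

text \<open>Turns the skewness axiom, stated with \<open>swap\<close>, into a statement about
  \<open>place\<close>, the form in which r-matrices are moved between factors.\<close>

lemma swap_eq_place: "swap 1 2 p = place (2::2) 1 p"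
  unfolding swap_def place_def
  by (rule arg_cong[where f = "\<lambda>h. push h p"]) (use UNIV_two in \<open>auto simp: fun_eq_iff\<close>)

text \<open>The letter map may differ from factor to factor; this is what sends the factors of an
  identity over one Lie algebra to different summands of its power.\<close>

definition transport :: "('i \<Rightarrow> 'l \<Rightarrow> 'm) \<Rightarrow> ('k::field_char_0, 'l, 'i) env_power \<Rightarrow> ('k, 'm, 'i) env_power" where
  "transport g = push (\<lambda>w s. map_monomial (g s) (w s))"

lemma transport_add: "transport g (p + q) = transport g p + transport g q"
  and transport_minus: "transport g (- p) = - transport g p"
  and transport_diff: "transport g (p - q) = transport g p - transport g q"
  by (simp_all add: transport_def push_add push_minus push_diff)

lemma transport_zero [simp]: "transport g 0 = 0"
  by (simp add: transport_def)

lemma map_monomial_plus: "map_monomial f (u + v) = map_monomial f u + map_monomial f v"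
  by (cases u; cases v) (simp add: plus_monomial_def)

lemma map_monomial_zero [simp]: "map_monomial f 0 = 0"
  by (simp add: zero_monomial_def)

lemma transport_mult: "transport g (p * q) = transport g p * transport g q"
  unfolding transport_def by (rule push_mult) (simp add: fun_eq_iff map_monomial_plus)

lemma transport_scalar [simp]: "transport g (scalar a) = scalar a"
  by (auto simp: transport_def fun_eq_iff intro!: arg_cong[where f = "\<lambda>w. Poly_Mapping.single w _"])

lemma transport_one [simp]: "transport g 1 = 1"
  using transport_scalar[of g 1] by (simp add: single_one)

lemma transport_emb [simp]: "transport g (emb i x) = emb i (g i x)"
  by (auto simp: transport_def emb_def fun_eq_iff intro!: arg_cong[where f = "\<lambda>w. Poly_Mapping.single w _"])

lemma transport_tens: "transport g (tens i j ts) = tens i j (map (map_prod (g i) (g j)) ts)"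
  by (induction ts) (auto simp: transport_add transport_mult)

lemma transport_commutator: "transport g (commutator p q) = commutator (transport g p) (transport g q)"
  by (simp add: commutator_def transport_diff transport_mult)

lemma env_eq_transport:
  assumes "\<And>i. lie_hom sc br sc' br' (g i)" "env_eq sc br p q"
  shows "env_eq sc' br' (transport g p) (transport g q)"
  by (rule env_eq_tensor_hom[where h = g and \<sigma> = "\<lambda>s. s" and sc = sc and br = br])
    (use assms in \<open>auto simp: transport_add transport_mult\<close>)

section \<open>Invariant elements and the Yang-Baxter equation with mixed blocks\<close>

lemma tens_commute_emb:
  assumes "k \<noteq> i" "k \<noteq> j"
  shows "commutator (tens i j ts) (emb k x) = (0 :: ('k::field_char_0, 'l, 'i) env_power)"
proof (induction ts)
  case (Cons t ts)
  obtain a b where t: "t = (a, b)" by (cases t)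
  have "commutator (emb i a) (emb k x) = (0 :: ('k, 'l, 'i) env_power)"
    "commutator (emb j b) (emb k x) = (0 :: ('k, 'l, 'i) env_power)"
    using assms by (simp_all add: commutator_def emb_commute[of k])
  then show ?case using Cons by (simp add: t commutator_add_left commutator_mult_left)
qed simp

text \<open>For each term (a, b) of \<open>ts\<close> the sum factors as the coproduct of a in the
  factors i, j times the letter b in factor k, and \<open>t\<close> commutes with both.\<close>

lemma commutator_tens_first:
  assumes ij: "\<And>x. env_eq sc br (commutator t (emb i x + emb j x)) 0"
    and k: "\<And>x. env_eq sc br (commutator t (emb k x)) 0"
  shows "env_eq sc br (commutator t (tens i k ts + tens j k ts)) 0"
proof (induction ts)
  case (Cons u ts)
  obtain a b where u: "u = (a, b)" by (cases u)
  have "commutator t (tens i k (u # ts) + tens j k (u # ts)) =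
    commutator t ((emb i a + emb j a) * emb k b) + commutator t (tens i k ts + tens j k ts)"
    by (simp add: u commutator_def algebra_simps)
  then show ?case
    using env_eq_null_add[OF commutator_mult_right_null[OF ij[of a] k[of b]] Cons] by simp
qed simp

lemma commutator_tens_second:
  assumes ij: "\<And>x. env_eq sc br (commutator t (emb i x + emb j x)) 0"
    and k: "\<And>x. env_eq sc br (commutator t (emb k x)) 0"
  shows "env_eq sc br (commutator t (tens k i ts + tens k j ts)) 0"
proof (induction ts)
  case (Cons u ts)
  obtain a b where u: "u = (a, b)" by (cases u)
  have "commutator t (tens k i (u # ts) + tens k j (u # ts)) =
    commutator t (emb k a * (emb i b + emb j b)) + commutator t (tens k i ts + tens k j ts)"
    by (simp add: u commutator_def algebra_simps)
  then show ?case
    using env_eq_null_add[OF commutator_mult_right_null[OF k[of a] ij[of b]] Cons] by simp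
qed simp

text \<open>The three arguments are the blocks of an r-matrix on a direct sum that meet in one component of the equation.\<close>

definition cyb :: "('l \<times> 'l) list \<Rightarrow> ('l \<times> 'l) list \<Rightarrow> ('l \<times> 'l) list \<Rightarrow> ('k::field_char_0, 'l, 3) env_power" where
  "cyb p q s = commutator (tens 1 2 p) (tens 1 3 q) + commutator (tens 1 2 p) (tens 2 3 s)
     + commutator (tens 1 3 q) (tens 2 3 s)"

definition opposite :: "('k::field_char_0 \<Rightarrow> 'l::ab_group_add \<Rightarrow> 'l) \<Rightarrow> ('l \<Rightarrow> 'l \<Rightarrow> 'l) \<Rightarrow>
  ('l \<times> 'l) list \<Rightarrow> ('l \<times> 'l) list \<Rightarrow> bool" where
  "opposite sc br p s \<longleftrightarrow> env_eq sc br (tens 1 2 p + tens 2 1 s :: ('k, 'l, 2) env_power) 0"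

lemma opposite_tens:
  assumes "opposite sc br p s" "i \<noteq> j"
  shows "env_eq sc br (tens i j p + tens j i s) 0"
  using env_eq_place[OF assms(2) assms(1)[unfolded opposite_def]] assms(2)
  by (simp add: place_add place_tens)

lemma opposite_sym: "opposite sc br p s \<Longrightarrow> opposite sc br s p"
  unfolding opposite_def[of _ _ s] using opposite_tens[of sc br p s "2::2" 1] by (simp add: add.commute)

text \<open>The list for -r_21. Lists carry no coefficients, so the sign is absorbed into one leg by
  scalar multiplication.\<close>

definition negflip :: "('k::field_char_0 \<Rightarrow> 'l \<Rightarrow> 'l) \<Rightarrow> ('l \<times> 'l) list \<Rightarrow> ('l \<times> 'l) list" where
  "negflip sc ts = map (\<lambda>(a, b). (sc (- 1) b, a)) ts"

lemma scalar_minus_one: "scalar (- 1) = (- 1 :: 'x::monoid_add \<Rightarrow>\<^sub>0 'k::field_char_0)"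
  by (metis single_one single_uminus)

lemma opposite_negflip:
  fixes sc :: "'k::field_char_0 \<Rightarrow> 'l::ab_group_add \<Rightarrow> 'l"
  shows "opposite sc br (negflip sc ts) ts"
  unfolding opposite_def
proof (induction ts)
  case (Cons t ts)
  obtain a b where t: "t = (a, b)" by (cases t)
  have "env_eq sc br (emb 1 (sc (- 1) b) * emb 2 a + emb 2 a * emb 1 b)
     (scalar (- 1) * emb 1 b * emb 2 a + emb (2::2) a * emb 1 b)"
    by (intro env_eq_add env_eq_mult emb_scale env_eq_refl)
  also have "scalar (- 1) * emb 1 b * emb 2 a + emb (2::2) a * emb 1 b = (0 :: ('k, 'l, 2) env_power)"
    by (simp add: scalar_minus_one emb_commute[of "2::2" 1])
  finally show ?case
    using env_eq_null_add[OF _ Cons] by (force simp: t negflip_def algebra_simps)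
qed (simp add: negflip_def)

definition induces ::
  "('k::field_char_0 \<Rightarrow> 'l::ab_group_add \<Rightarrow> 'l) \<Rightarrow> ('l \<Rightarrow> 'l \<Rightarrow> 'l) \<Rightarrow>
   ('l \<Rightarrow> ('k, 'l, 2) env_power) \<Rightarrow> ('l \<times> 'l) list \<Rightarrow> bool" where
  "induces sc br \<delta> ts \<longleftrightarrow> (\<forall>x. env_eq sc br (commutator (tens 1 2 ts) (coprod x)) (\<delta> x))"

lemma induces_place:
  assumes "induces sc br \<delta> ts" "i \<noteq> j"
  shows "env_eq sc br (commutator (tens i j ts) (emb i x + emb j x)) (place i j (\<delta> x))"
  using env_eq_place[OF assms(2), of sc br "commutator (tens 1 2 ts) (coprod x)" "\<delta> x"] assms
  by (simp add: induces_def place_commutator place_tens place_coprod)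

lemma induces_diff_invariant:
  assumes "induces sc br \<delta> p" "induces sc br \<delta> q" "i \<noteq> j"
  shows "env_eq sc br (commutator (tens i j p - tens i j q) (emb i x + emb j x)) 0"
  using env_eq_diff[OF induces_place[OF assms(1,3), of x] induces_place[OF assms(2,3), of x]]
  by (simp add: commutator_diff_left)

text \<open>Exchanging the last block for \<open>p\<close> costs a commutator of the invariant
  element s - p in the factors 2, 3 with \<open>p\<close> whose second leg is spread over these
  factors, and that commutator is null.\<close>

lemma cyb_equal_left:
  fixes sc :: "'k::field_char_0 \<Rightarrow> 'l::ab_group_add \<Rightarrow> 'l"
  assumes "induces sc br \<delta> p" "induces sc br \<delta> s" "env_eq sc br (cyb p p p) 0"
  shows "env_eq sc br (cyb p p s) 0"
proof -
  have "cyb p p s = (cyb p p p :: ('k, 'l, 3) env_power) + - commutator (tens 2 3 s - tens 2 3 p) (tens 1 2 p + tens 1 3 p)"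
    by (simp add: cyb_def commutator_def algebra_simps)
  moreover have "env_eq sc br (commutator (tens 2 3 s - tens 2 3 p) (tens 1 2 p + tens 1 3 p :: ('k, 'l, 3) env_power)) 0"
    by (rule commutator_tens_second)
      (rule induces_diff_invariant[OF assms(2,1)], simp, simp add: commutator_diff_left tens_commute_emb)
  ultimately show ?thesis using env_eq_null_add[OF assms(3) env_eq_null_minus] by fastforce
qed

lemma cyb_equal_right:
  fixes sc :: "'k::field_char_0 \<Rightarrow> 'l::ab_group_add \<Rightarrow> 'l"
  assumes "induces sc br \<delta> p" "induces sc br \<delta> s" "env_eq sc br (cyb s s s) 0"
  shows "env_eq sc br (cyb p s s) 0"
proof -
  have "cyb p s s = (cyb s s s :: ('k, 'l, 3) env_power) + commutator (tens 1 2 p - tens 1 2 s) (tens 1 3 s + tens 2 3 s)"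
    by (simp add: cyb_def commutator_def algebra_simps)
  moreover have "env_eq sc br (commutator (tens 1 2 p - tens 1 2 s) (tens 1 3 s + tens 2 3 s :: ('k, 'l, 3) env_power)) 0"
    by (rule commutator_tens_first)
      (rule induces_diff_invariant[OF assms(1,2)], simp, simp add: commutator_diff_left tens_commute_emb)
  ultimately show ?thesis using env_eq_null_add[OF assms(3)] by simp
qed

text \<open>The factors 1, 3 carry the invariant element q - s. As p_12 is -s_21, what it meets is
  s_21 + s_23, which is \<open>s\<close> with its second leg spread over the factors 1 and 3. So q
  can be exchanged for s, and \<open>cyb_equal_right\<close> applies.\<close>

lemma cyb_opposite:
  fixes sc :: "'k::field_char_0 \<Rightarrow> 'l::ab_group_add \<Rightarrow> 'l"
  assumes "induces sc br \<delta> p" "induces sc br \<delta> q" "induces sc br \<delta> s" "env_eq sc br (cyb s s s) 0"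
    and opp: "opposite sc br p s"
  shows "env_eq sc br (cyb p q s) 0"
proof -
  let ?t = "tens 1 3 q - tens 1 3 s :: ('k, 'l, 3) env_power"
  have "cyb p q s = (cyb p s s :: ('k, 'l, 3) env_power) +
     (commutator ?t (tens 2 1 s + tens 2 3 s) - commutator ?t (tens 1 2 p + tens 2 1 s))"
    by (simp add: cyb_def commutator_def algebra_simps)
  moreover have "env_eq sc br (commutator ?t (tens 2 1 s + tens 2 3 s :: ('k, 'l, 3) env_power)) 0"
    by (rule commutator_tens_second)
      (rule induces_diff_invariant[OF assms(2,3)], simp, simp add: commutator_diff_left tens_commute_emb)
  moreover have "env_eq sc br (commutator ?t (tens 1 2 p + tens 2 1 s)) (commutator ?t 0)"
    by (intro env_eq_commutator env_eq_refl opposite_tens opp) simp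
  ultimately show ?thesis using env_eq_null_add[OF cyb_equal_right[OF assms(1,3,4)]] env_eq_diff by fastforce
qed

text \<open>The Yang-Baxter equation passes from r to -r_21: the middle block of
  \<open>cyb_opposite\<close> is free and can be taken to be \<open>p\<close>, and the last block is
  then exchanged as in \<open>cyb_equal_left\<close>.\<close>

lemma cyb_opposite_self:
  fixes sc :: "'k::field_char_0 \<Rightarrow> 'l::ab_group_add \<Rightarrow> 'l"
  assumes "induces sc br \<delta> p" "induces sc br \<delta> s" "env_eq sc br (cyb s s s) 0" "opposite sc br p s"
  shows "env_eq sc br (cyb p p p) 0"
proof -
  have "cyb p p p = (cyb p p s :: ('k, 'l, 3) env_power) + commutator (tens 2 3 s - tens 2 3 p) (tens 1 2 p + tens 1 3 p)"
    by (simp add: cyb_def commutator_def algebra_simps)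
  moreover have "env_eq sc br (commutator (tens 2 3 s - tens 2 3 p) (tens 1 2 p + tens 1 3 p :: ('k, 'l, 3) env_power)) 0"
    by (rule commutator_tens_second)
      (rule induces_diff_invariant[OF assms(2,1)], simp, simp add: commutator_diff_left tens_commute_emb)
  moreover have "env_eq sc br (cyb p p s) 0" by (rule cyb_opposite) (use assms in auto)
  ultimately show ?thesis using env_eq_null_add by metis
qed

context lie_bialgebra
begin

text \<open>Flipping the commutator of r with a coproduct gives the flip of the cobracket, which is
  its negative by skewness; the two signs cancel.\<close>

lemma induces_opposite:
  assumes s: "induces sc br \<delta> s" and opp: "opposite sc br p s"
  shows "induces sc br \<delta> p"
  unfolding induces_def
proof
  fix x
  have "env_eq sc br (- commutator (tens 2 1 s) (coprod x)) (- place 2 1 (\<delta> x))"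
    using induces_place[OF s, of "2::2" 1 x] by (simp add: env_eq_minus coprod_def add.commute)
  also have "env_eq sc br \<dots> (\<delta> x)"
    using env_eq_minus[OF skew[of x]] by (simp add: swap_eq_place)
  finally have "env_eq sc br (- commutator (tens 2 1 s) (coprod x)) (\<delta> x)" .
  moreover have "env_eq sc br (commutator (tens 1 2 p + tens 2 1 s) (coprod x)) (commutator 0 (coprod x))"
    using opp by (intro env_eq_commutator env_eq_refl) (simp add: opposite_def)
  ultimately show "env_eq sc br (commutator (tens 1 2 p) (coprod x)) (\<delta> x)"
    using env_eq_add[of sc br "- commutator (tens 2 1 s) (coprod x)" "\<delta> x"]
    by (fastforce simp: commutator_add_left)
qed

text \<open>r + r_21 is the difference of r and -r_21, and both of these induce the
  cobracket.\<close>

lemma induces_symmetric_invariant: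
  assumes "induces sc br \<delta> s" "i \<noteq> j"
  shows "env_eq sc br (commutator (tens i j s + tens j i s) (emb i x + emb j x)) 0"
proof -
  have o: "opposite sc br (negflip sc s) s" by (rule opposite_negflip)
  have "env_eq sc br (commutator (tens i j (negflip sc s) + tens j i s) (emb i x + emb j x))
    (commutator 0 (emb i x + emb j x))"
    using assms by (intro env_eq_commutator env_eq_refl opposite_tens o)
  moreover have "env_eq sc br (commutator (tens i j s - tens i j (negflip sc s)) (emb i x + emb j x)) 0"
    using induces_diff_invariant[OF assms(1) induces_opposite[OF assms(1) o] assms(2)] .
  ultimately show ?thesis using env_eq_null_add
    by (fastforce simp: commutator_add_left commutator_diff_left)
qed

lemma r_matrix_list:
  assumes "r_matrix sc br \<delta> \<rho>"
  obtains ts where "env_eq sc br \<rho> (tens 1 2 ts)" "induces sc br \<delta> ts" "env_eq sc br (cyb ts ts ts) 0"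
proof -
  from assms obtain ts where ts: "env_eq sc br \<rho> (tens 1 2 ts)"
    by (auto simp: r_matrix_def in_lie_square_def pure_sum_eq_tens)
  have "env_eq sc br (commutator (tens 1 2 ts) (coprod x)) (\<delta> x)" for x
  proof -
    have "env_eq sc br (commutator (tens 1 2 ts) (coprod x)) (commutator \<rho> (coprod x))"
      by (intro env_eq_commutator env_eq_refl env_eq_sym[OF ts])
    also have "env_eq sc br \<dots> (\<delta> x)" using assms by (auto simp: r_matrix_def intro: env_eq_sym)
    finally show ?thesis .
  qed
  moreover have pl: "env_eq sc br (place i j \<rho>) (tens i j ts)" if "i \<noteq> j" for i j :: 3
    using env_eq_place[OF that ts] that by (simp add: place_tens)
  have cyb: "env_eq sc br (cyb ts ts ts)
    (commutator (place 1 2 \<rho>) (place 1 3 \<rho>) + commutator (place 1 2 \<rho>) (place 2 3 \<rho>)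
          + commutator (place 1 3 \<rho>) (place 2 3 \<rho>))"
    unfolding cyb_def by (intro env_eq_add env_eq_commutator env_eq_sym[OF pl]) simp_all
  have "env_eq sc br (cyb ts ts ts) 0"
    by (rule env_eq_trans[OF cyb]) (use assms in \<open>simp add: r_matrix_def\<close>)
  with ts calculation show thesis by (intro that) (auto simp: induces_def)
qed

end

section \<open>The twisted r-matrix on a power of a Lie algebra\<close>

definition power_sc :: "('k \<Rightarrow> 'l \<Rightarrow> 'l) \<Rightarrow> 'k \<Rightarrow> ('n \<Rightarrow> 'l) \<Rightarrow> ('n \<Rightarrow> 'l)" where
  "power_sc sc a x = (\<lambda>i. sc a (x i))"

definition power_br :: "('l \<Rightarrow> 'l \<Rightarrow> 'l) \<Rightarrow> ('n \<Rightarrow> 'l) \<Rightarrow> ('n \<Rightarrow> 'l) \<Rightarrow> ('n \<Rightarrow> 'l)" where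
  "power_br br x y = (\<lambda>i. br (x i) (y i))"

definition incl :: "'n \<Rightarrow> 'l::zero \<Rightarrow> ('n \<Rightarrow> 'l)" where
  "incl i x = (\<lambda>_. 0)(i := x)"

lemma incl_eta: "fun_upd (\<lambda>_. 0) i = incl i"
  by (simp add: incl_def fun_eq_iff)

lemma sum_fun_apply: "(\<Sum>x\<in>S. f x) y = (\<Sum>x\<in>S. f x y)"
  by (induction S rule: infinite_finite_induct) auto

lemma sum_incl: "(\<Sum>i\<in>UNIV. incl i (x i)) = (x :: 'n::finite \<Rightarrow> 'l::comm_monoid_add)"
proof
  fix j
  have "(\<Sum>i\<in>UNIV. incl i (x i)) j = (\<Sum>i\<in>UNIV. if i = j then x i else 0)"
    unfolding sum_fun_apply by (rule sum.cong) (auto simp: incl_def)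
  then show "(\<Sum>i\<in>UNIV. incl i (x i)) j = x j" by simp
qed

context lie_algebra
begin

lemma br_zero_left [simp]: "br 0 x = 0"
  using br_add_left[of 0 0 x] by simp

lemma br_zero_right [simp]: "br x 0 = 0"
  using br_add_right[of x 0 0] by simp

lemma lie_hom_incl: "lie_hom sc br (power_sc sc) (power_br br) (incl i)"
  by (auto simp: lie_hom_def power_sc_def power_br_def incl_def fun_eq_iff)

lemma lie_hom_diagonal: "lie_hom sc br (power_sc sc) (power_br br) (\<lambda>x _. x)"
  by (auto simp: lie_hom_def power_sc_def power_br_def fun_eq_iff)

text \<open>In one tensor factor the commutator is the letter of the bracket, which vanishes in
  every coordinate; in distinct factors letters commute already before passing to the
  quotient.\<close>

lemma emb_incl_commute:
  assumes "s = t \<Longrightarrow> Y a = 0"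
  shows "env_eq (power_sc sc) (power_br br) (commutator (emb s (incl a u)) (emb t Y)) 0"
proof (cases "s = t")
  case True
  have "power_br br (incl a u) Y = 0"
    using assms[OF True] by (auto simp: power_br_def incl_def fun_eq_iff)
  then show ?thesis
    using env_eq_trans[OF emb_bracket[of "power_sc sc" "power_br br" s "incl a u" Y]] emb_zero True by force
next
  case False
  then show ?thesis by (simp add: commutator_def emb_commute[of s t])
qed

lemma tens_incl_commute:
  assumes "s = i \<Longrightarrow> Y a = 0" "s = j \<Longrightarrow> Y b = 0"
  shows "env_eq (power_sc sc) (power_br br)
    (commutator (tens i j (map (map_prod (incl a) (incl b)) ts)) (emb s Y)) 0"
proof (induction ts)
  case (Cons t ts)
  obtain u v where t: "t = (u, v)" by (cases t)
  have "env_eq (power_sc sc) (power_br br) (commutator (emb i (incl a u) * emb j (incl b v)) (emb s Y)) 0"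
    by (intro commutator_mult_left_null emb_incl_commute) (use assms in auto)
  then show ?case using env_eq_null_add[OF _ Cons] by (simp add: t commutator_add_left)
qed simp

lemma commutator_tens_null:
  assumes "\<And>u v. (u, v) \<in> set ts \<Longrightarrow> env_eq sc' br' (commutator t (emb i u)) 0"
    and "\<And>u v. (u, v) \<in> set ts \<Longrightarrow> env_eq sc' br' (commutator t (emb j v)) 0"
  shows "env_eq sc' br' (commutator t (tens i j ts)) 0"
  using assms
proof (induction ts)
  case (Cons x ts)
  obtain u v where x: "x = (u, v)" by (cases x)
  have "env_eq sc' br' (commutator t (emb i u * emb j v)) 0"
    by (rule commutator_mult_right_null) (use Cons.prems x in auto)
  moreover have "env_eq sc' br' (commutator t (tens i j ts)) 0"
    by (rule Cons.IH) (use Cons.prems in auto)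
  ultimately show ?case using env_eq_null_add by (force simp: x commutator_add_right)
qed simp

end

lemma env_eq_sum_single:
  fixes f :: "'a::finite \<Rightarrow> ('k::field_char_0, 'l::ab_group_add, 'i) env_power"
  assumes "\<And>x. x \<noteq> a \<Longrightarrow> env_eq sc br (f x) 0"
  shows "env_eq sc br (\<Sum>x\<in>UNIV. f x) (f a)"
proof -
  have "env_eq sc br (\<Sum>x\<in>UNIV. f x) (\<Sum>x\<in>UNIV. if x = a then f a else 0)"
    by (rule env_eq_sum) (use assms in auto)
  then show ?thesis by simp
qed

lemma tens_concat: "tens i j (concat (map f ps)) = (\<Sum>p\<leftarrow>ps. tens i j (f p))"
  by (induction ps) auto

text \<open>Isolates what the power construction uses of the family and the array: one list for each
  pair of summands. Transitivity enters as \<open>triple\<close>, which covers all orders and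
  coincidences of the three indices.\<close>

locale r_array = lie_bialgebra sc br \<delta>
  for sc :: "'k::field_char_0 \<Rightarrow> 'l::ab_group_add \<Rightarrow> 'l" and br \<delta> +
  fixes \<rho> :: "'n::{finite,linorder} \<Rightarrow> 'n \<Rightarrow> ('l \<times> 'l) list"
  assumes induces: "induces sc br \<delta> (\<rho> a b)"
    and cyb_self: "env_eq sc br (cyb (\<rho> a b) (\<rho> a b) (\<rho> a b)) 0"
    and opposite: "a \<noteq> b \<Longrightarrow> opposite sc br (\<rho> a b) (\<rho> b a)"
    and triple: "\<rho> a c = \<rho> a b \<or> \<rho> a c = \<rho> b c \<or> opposite sc br (\<rho> a b) (\<rho> b c)"
begin

abbreviation eqn :: "('k, 'n \<Rightarrow> 'l, 'i) env_power \<Rightarrow> ('k, 'n \<Rightarrow> 'l, 'i) env_power \<Rightarrow> bool" where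
  "eqn \<equiv> env_eq (power_sc sc) (power_br br)"

abbreviation block :: "'i \<Rightarrow> 'i \<Rightarrow> 'n \<Rightarrow> 'n \<Rightarrow> ('k, 'n \<Rightarrow> 'l, 'i) env_power" where
  "block i j a b \<equiv> tens i j (map (map_prod (incl a) (incl b)) (\<rho> a b))"

definition blocks :: "(('n \<Rightarrow> 'l) \<times> ('n \<Rightarrow> 'l)) list" where
  "blocks = concat (map (\<lambda>(a, b). map (map_prod (incl a) (incl b)) (\<rho> a b))
     (List.product (sorted_list_of_set UNIV) (sorted_list_of_set UNIV)))"

lemma tens_blocks: "tens i j blocks = (\<Sum>a\<in>UNIV. \<Sum>b\<in>UNIV. block i j a b)"
proof -
  let ?l = "sorted_list_of_set (UNIV :: 'n set)"
  have "tens i j blocks = (\<Sum>(a, b)\<in>set (List.product ?l ?l). block i j a b)"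
    unfolding blocks_def tens_concat
    by (subst sum_list_distinct_conv_sum_set) (auto simp: distinct_product case_prod_unfold)
  then show ?thesis by (simp add: sum.cartesian_product)
qed

lemma cyb_mixed: "env_eq sc br (cyb (\<rho> a b) (\<rho> a c) (\<rho> b c)) 0"
  using triple[of a c b]
proof (elim disjE)
  assume "opposite sc br (\<rho> a b) (\<rho> b c)"
  then show ?thesis by (rule cyb_opposite[OF induces induces induces cyb_self])
next
  assume "\<rho> a c = \<rho> a b"
  then show ?thesis using cyb_equal_left[OF induces[of a b] induces[of b c] cyb_self] by simp
next
  assume "\<rho> a c = \<rho> b c"
  then show ?thesis using cyb_equal_right[OF induces[of a b] induces[of b c] cyb_self] by simp
qed

text \<open>Two blocks can fail to commute only if they share a tensor factor and a summand in it.
  In the Yang-Baxter expression the shared factor thus forces its two indices to agree, and a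
  fourfold sum collapses to a threefold one.\<close>

lemma block_null:
  assumes "i = k \<Longrightarrow> a \<noteq> c" "i = l \<Longrightarrow> a \<noteq> d" "j = k \<Longrightarrow> b \<noteq> c" "j = l \<Longrightarrow> b \<noteq> d"
  shows "eqn (commutator (block i j a b) (block k l c d)) 0"
  by (intro commutator_tens_null tens_incl_commute) (use assms in \<open>auto simp: incl_def\<close>)

lemma cyb_blocks: "eqn (cyb blocks blocks blocks) 0"
proof -
  let ?c = "\<lambda>i j k l a b c d. commutator (block i j a b) (block k l c d) :: ('k, 'n \<Rightarrow> 'l, 3) env_power"
  have "eqn (commutator (tens 1 2 blocks) (tens 1 3 blocks))
     (\<Sum>a\<in>UNIV. \<Sum>b\<in>UNIV. \<Sum>c\<in>UNIV. ?c 1 2 1 3 a b a c)"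
  proof -
    have eq: "commutator (tens 1 2 blocks) (tens 1 3 blocks) =
        (\<Sum>a\<in>UNIV. \<Sum>b\<in>UNIV. \<Sum>a'\<in>UNIV. \<Sum>c\<in>UNIV. ?c 1 2 1 3 a b a' c)"
      unfolding tens_blocks commutator_sum_left unfolding commutator_sum_right ..
    have red: "eqn (\<Sum>a'\<in>UNIV. \<Sum>c\<in>UNIV. ?c 1 2 1 3 a b a' c) (\<Sum>c\<in>UNIV. ?c 1 2 1 3 a b a c)" for a b
      by (rule env_eq_sum_single) (intro env_eq_null_sum block_null, auto)
    show ?thesis unfolding eq by (rule env_eq_sum, rule env_eq_sum, rule red)
  qed
  moreover have "eqn (commutator (tens 1 2 blocks) (tens 2 3 blocks))
     (\<Sum>a\<in>UNIV. \<Sum>b\<in>UNIV. \<Sum>c\<in>UNIV. ?c 1 2 2 3 a b b c)"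
  proof -
    have eq: "commutator (tens 1 2 blocks) (tens 2 3 blocks) =
        (\<Sum>a\<in>UNIV. \<Sum>b\<in>UNIV. \<Sum>b'\<in>UNIV. \<Sum>c\<in>UNIV. ?c 1 2 2 3 a b b' c)"
      unfolding tens_blocks commutator_sum_left unfolding commutator_sum_right ..
    have red: "eqn (\<Sum>b'\<in>UNIV. \<Sum>c\<in>UNIV. ?c 1 2 2 3 a b b' c) (\<Sum>c\<in>UNIV. ?c 1 2 2 3 a b b c)" for a b
      by (rule env_eq_sum_single) (intro env_eq_null_sum block_null, auto)
    show ?thesis unfolding eq by (rule env_eq_sum, rule env_eq_sum, rule red)
  qed
  moreover have "eqn (commutator (tens 1 3 blocks) (tens 2 3 blocks))
     (\<Sum>a\<in>UNIV. \<Sum>b\<in>UNIV. \<Sum>c\<in>UNIV. ?c 1 3 2 3 a c b c)"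
  proof -
    have eq: "commutator (tens 1 3 blocks) (tens 2 3 blocks) =
        (\<Sum>a\<in>UNIV. \<Sum>c\<in>UNIV. \<Sum>b\<in>UNIV. \<Sum>c'\<in>UNIV. ?c 1 3 2 3 a c b c')"
      unfolding tens_blocks commutator_sum_left unfolding commutator_sum_right ..
    have red: "eqn (\<Sum>c'\<in>UNIV. ?c 1 3 2 3 a c b c') (?c 1 3 2 3 a c b c)" for a b c
      by (rule env_eq_sum_single) (intro block_null, auto)
    have "eqn (commutator (tens 1 3 blocks) (tens 2 3 blocks))
       (\<Sum>a\<in>UNIV. \<Sum>c\<in>UNIV. \<Sum>b\<in>UNIV. ?c 1 3 2 3 a c b c)"
      unfolding eq by (rule env_eq_sum, rule env_eq_sum, rule env_eq_sum, rule red)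
    also have "(\<Sum>a\<in>UNIV. \<Sum>c\<in>UNIV. \<Sum>b\<in>UNIV. ?c 1 3 2 3 a c b c) =
       (\<Sum>a\<in>UNIV. \<Sum>b\<in>UNIV. \<Sum>c\<in>UNIV. ?c 1 3 2 3 a c b c)"
      by (rule sum.cong[OF refl], rule sum.swap)
    finally show ?thesis .
  qed
  ultimately have "eqn (cyb blocks blocks blocks)
     ((\<Sum>a\<in>UNIV. \<Sum>b\<in>UNIV. \<Sum>c\<in>UNIV. ?c 1 2 1 3 a b a c) +
      (\<Sum>a\<in>UNIV. \<Sum>b\<in>UNIV. \<Sum>c\<in>UNIV. ?c 1 2 2 3 a b b c) +
      (\<Sum>a\<in>UNIV. \<Sum>b\<in>UNIV. \<Sum>c\<in>UNIV. ?c 1 3 2 3 a c b c))"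
    unfolding cyb_def by (intro env_eq_add)
  also have "\<dots> = (\<Sum>a\<in>UNIV. \<Sum>b\<in>UNIV. \<Sum>c\<in>UNIV.
     ?c 1 2 1 3 a b a c + ?c 1 2 2 3 a b b c + ?c 1 3 2 3 a c b c)"
    by (simp add: sum.distrib)
  also have "eqn \<dots> 0"
  proof (intro env_eq_null_sum)
    fix a b c :: 'n
    \<comment> \<open>Sending factors 1, 2, 3 to the summands a, b, c makes this component the image
      of the mixed equation over the single Lie algebra.\<close>
    let ?g = "\<lambda>s::3. if s = 1 then incl a else if s = 2 then incl b else incl c"
    have "eqn (transport ?g (cyb (\<rho> a b) (\<rho> a c) (\<rho> b c))) (transport ?g 0)"
      by (intro env_eq_transport[of sc br] cyb_mixed) (auto intro: lie_hom_incl)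
    moreover have "transport ?g (cyb (\<rho> a b) (\<rho> a c) (\<rho> b c)) =
        ?c 1 2 1 3 a b a c + ?c 1 2 2 3 a b b c + ?c 1 3 2 3 a c b c"
      by (simp add: cyb_def transport_add transport_commutator transport_tens)
    ultimately show "eqn (?c 1 2 1 3 a b a c + ?c 1 2 2 3 a b b c + ?c 1 3 2 3 a c b c) 0"
      by simp
  qed
  finally show ?thesis .
qed

lemma env_eq_transport_incl:
  "env_eq sc br p q \<Longrightarrow> eqn (transport (\<lambda>s. incl (h s)) p) (transport (\<lambda>s. incl (h s)) q)"
  by (rule env_eq_transport[of sc br]) (auto intro: lie_hom_incl)

text \<open>What remains of \<open>X\<close> after removing its component in one summand vanishes in
  that summand, so the hypotheses discard it. Thus a block only sees \<open>X a\<close> in its first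
  leg and \<open>X b\<close> in its second.\<close>

lemma commutator_incl_coprod:
  fixes t :: "('k, 'n \<Rightarrow> 'l, 2) env_power"
  assumes "\<And>Y. Y a = 0 \<Longrightarrow> eqn (commutator t (emb 1 Y)) 0" "\<And>Y. Y b = 0 \<Longrightarrow> eqn (commutator t (emb 2 Y)) 0"
  shows "eqn (commutator t (coprod X)) (commutator t (emb 1 (incl a (X a)) + emb 2 (incl b (X b))))"
proof -
  have *: "eqn (commutator t (emb s X)) (commutator t (emb s (incl c (X c))))"
    if "\<And>Y. Y c = 0 \<Longrightarrow> eqn (commutator t (emb s Y)) 0" for s c
  proof -
    have "X = incl c (X c) + X(c := 0)" by (auto simp: fun_eq_iff incl_def)
    then have "eqn (emb s X) (emb s (incl c (X c)) + emb s (X(c := 0)))"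
      by (metis emb_add)
    then have "eqn (commutator t (emb s X)) (commutator t (emb s (incl c (X c)) + emb s (X(c := 0))))"
      by (intro env_eq_commutator env_eq_refl)
    also have "commutator t (emb s (incl c (X c)) + emb s (X(c := 0))) =
        commutator t (emb s (incl c (X c))) + commutator t (emb s (X(c := 0)))"
      by (rule commutator_add_right)
    also have "eqn \<dots> (commutator t (emb s (incl c (X c))) + 0)"
      by (intro env_eq_add env_eq_refl that) simp
    finally show ?thesis by simp
  qed
  show ?thesis unfolding coprod_def commutator_add_right
    by (intro env_eq_add *) (use assms in auto)
qed

lemma blocks_symmetric_invariant: "eqn (commutator (tens 1 2 blocks + tens 2 1 blocks) (coprod X)) 0"
proof -
  \<comment> \<open>The flipped block carries the swapped indices, so both terms live in summand a
    of factor 1 and summand b of factor 2. Off the diagonal they cancel by \<open>opposite\<close>;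
    on the diagonal only their invariance is available.\<close>
  let ?e = "\<lambda>a b. block 1 2 a b + block (2::2) 1 b a"
  have sum: "tens 1 2 blocks + tens (2::2) 1 blocks = (\<Sum>a\<in>UNIV. \<Sum>b\<in>UNIV. ?e a b)"
  proof -
    have "(\<Sum>a\<in>UNIV. \<Sum>b\<in>UNIV. block (2::2) 1 a b) = (\<Sum>a\<in>UNIV. \<Sum>b\<in>UNIV. block (2::2) 1 b a)"
      by (rule sum.swap)
    then show ?thesis by (simp add: tens_blocks sum.distrib)
  qed
  have "eqn (?e a b) 0" if "b \<noteq> a" for a b
  proof -
    have "env_eq sc br (tens 1 2 (\<rho> a b) + tens (2::2) 1 (\<rho> b a)) 0"
      using opposite that by (simp add: opposite_def)
    from env_eq_transport_incl[OF this, of "\<lambda>s. if s = 1 then a else b"]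
    show ?thesis by (simp add: transport_add transport_tens)
  qed
  then have "eqn (tens 1 2 blocks + tens (2::2) 1 blocks) (\<Sum>a\<in>UNIV. ?e a a)"
    unfolding sum by (intro env_eq_sum env_eq_sum_single)
  then have "eqn (commutator (tens 1 2 blocks + tens (2::2) 1 blocks) (coprod X))
     (commutator (\<Sum>a\<in>UNIV. ?e a a) (coprod X))"
    by (intro env_eq_commutator env_eq_refl)
  also have "commutator (\<Sum>a\<in>UNIV. ?e a a) (coprod X) = (\<Sum>a\<in>UNIV. commutator (?e a a) (coprod X))"
    by (rule commutator_sum_left)
  also have "eqn \<dots> 0"
  proof (intro env_eq_null_sum)
    fix a
    have "eqn (commutator (?e a a) (coprod X)) (commutator (?e a a) (emb 1 (incl a (X a)) + emb 2 (incl a (X a))))"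
      by (rule commutator_incl_coprod; unfold commutator_add_left)
        (intro env_eq_null_add tens_incl_commute, auto)+
    also have "\<dots> = transport (\<lambda>_. incl a) (commutator (tens 1 2 (\<rho> a a) + tens 2 1 (\<rho> a a)) (emb 1 (X a) + emb 2 (X a)))"
      by (simp add: transport_commutator transport_add transport_tens)
    also have "eqn \<dots> (transport (\<lambda>_. incl a) 0)"
      using env_eq_transport_incl[OF induces_symmetric_invariant[OF induces, of "1::2" 2 a a "X a"], of "\<lambda>_. a"]
      by simp
    finally show "eqn (commutator (?e a a) (coprod X)) 0" by simp
  qed
  finally show ?thesis .
qed

lemma emb_diagonal: "eqn (emb s (\<lambda>_. x)) (\<Sum>a\<in>UNIV. emb s (incl a x))"
  using emb_sum[of "power_sc sc" "power_br br" s "\<lambda>a::'n. incl a x" UNIV] by (simp add: sum_incl[of "\<lambda>_. x"])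

text \<open>Every block, whichever r-matrix it comes from, yields the same cobracket with legs in
  the summands a and b. Summed over all a and b, the two legs factor, and each assembles to a
  diagonal element.\<close>

lemma blocks_diagonal:
  "eqn (commutator (tens 1 2 blocks) (coprod (\<lambda>_. x))) (transport (\<lambda>_ x _. x) (\<delta> x))"
proof -
  obtain us where us: "env_eq sc br (\<delta> x) (tens 1 2 us)"
    using in_square[of x] by (auto simp: in_lie_square_def pure_sum_eq_tens)
  have "commutator (tens 1 2 blocks) (coprod (\<lambda>_. x)) =
     (\<Sum>a\<in>UNIV. \<Sum>b\<in>UNIV. commutator (block 1 2 a b) (coprod (\<lambda>_. x)))"
    by (simp add: tens_blocks commutator_sum_left)
  also have "eqn \<dots> (\<Sum>a\<in>UNIV. \<Sum>b\<in>UNIV. tens 1 2 (map (map_prod (incl a) (incl b)) us))"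
  proof (intro env_eq_sum)
    fix a b :: 'n
    let ?g = "\<lambda>s::2. incl (if s = 1 then a else b)"
    have "eqn (commutator (block 1 2 a b) (coprod (\<lambda>_. x)))
       (commutator (block 1 2 a b) (emb 1 (incl a x) + emb 2 (incl b x)))"
      by (rule commutator_incl_coprod) (intro tens_incl_commute, auto)+
    also have "\<dots> = transport ?g (commutator (tens 1 2 (\<rho> a b)) (coprod x))"
      by (simp add: coprod_def transport_commutator transport_add transport_tens)
    also have "eqn \<dots> (transport ?g (tens 1 2 us))"
      by (rule env_eq_transport_incl[OF env_eq_trans[OF _ us]]) (use induces in \<open>simp add: induces_def\<close>)
    finally show "eqn (commutator (block 1 2 a b) (coprod (\<lambda>_. x)))
        (tens 1 2 (map (map_prod (incl a) (incl b)) us))"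
      by (simp add: transport_tens)
  qed
  also have "(\<Sum>a\<in>UNIV. \<Sum>b\<in>UNIV. tens (1::2) 2 (map (map_prod (incl a) (incl b)) us)) =
     (\<Sum>(u, v)\<leftarrow>us. (\<Sum>a\<in>UNIV. emb 1 (incl a u)) * (\<Sum>b\<in>UNIV. emb 2 (incl b v)))"
    by (induction us) (auto simp: sum.distrib sum_product)
  also have "eqn \<dots> (\<Sum>(u, v)\<leftarrow>us. emb 1 (\<lambda>_. u) * emb 2 (\<lambda>_. v))"
    unfolding case_prod_unfold
    by (intro env_eq_sum_list env_eq_mult env_eq_sym[OF emb_diagonal])
  also have "\<dots> = transport (\<lambda>_ x _. x) (tens 1 2 us)"
    by (induction us) (auto simp: transport_add transport_mult)
  also have "eqn \<dots> (transport (\<lambda>_ x _. x) (\<delta> x))"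
    by (rule env_eq_transport[OF lie_hom_diagonal env_eq_sym[OF us]])
  finally show ?thesis .
qed

end

section \<open>The array r-matrix as a sum of blocks\<close>

lemma sum_list_single_index:
  fixes m :: "'m::monoid_add"
  assumes "distinct xs"
  shows "(\<Sum>i\<leftarrow>xs. if i = j then m else 0) = (if j \<in> set xs then m else 0)"
  using assms by (induction xs) auto

text \<open>In each half at most one of the concatenated words is nonempty, so regrouping amounts to
  a letter map. In the second form the first leg sits in the second half, whence the flip
  \<open>place 2 1\<close>.\<close>

lemma regroup_place:
  fixes p :: "('k::field_char_0, 'l::zero, 2) env_power" and i j :: "'n::{finite,linorder}"
  shows "regroup (place (Inl i) (Inr j) p) = transport (\<lambda>s. incl (if s = 1 then i else j)) p"
    and "regroup (place (Inr j) (Inl i) p) = transport (\<lambda>s. incl (if s = 1 then i else j)) (place 2 1 p)"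
proof -
  let ?l = "sorted_list_of_set (UNIV :: 'n set)"
  have e: "fun_upd (\<lambda>_. 0 :: 'l) i = incl i" for i :: 'n by (rule incl_eta)
  have s: "(\<Sum>k\<leftarrow>?l. map_monomial (incl k) (if k = i then v else 0)) = map_monomial (incl i) v"
    for v :: "'l monomial" and i
  proof -
    have "(\<Sum>k\<leftarrow>?l. map_monomial (incl k) (if k = i then v else 0)) =
       (\<Sum>k\<leftarrow>?l. if k = i then map_monomial (incl i) v else 0)"
      by (intro arg_cong[where f = sum_list] map_cong) auto
    then show ?thesis by (simp add: sum_list_single_index)
  qed
  show "regroup (place (Inl i) (Inr j) p) = transport (\<lambda>s. incl (if s = 1 then i else j)) p"
    unfolding regroup_def place_def transport_def push_push e
  proof (rule arg_cong[where f = "\<lambda>h. push h p"], rule ext, rule ext)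
    fix w :: "2 \<Rightarrow> 'l monomial" and s :: 2
    have "s = 1 \<or> s = 2" using UNIV_two by auto
    then have v: "((\<lambda>_. 0)(Inl i := w 1, Inr j := w 2)) (if s = 1 then Inl k else Inr k) =
        (if k = (if s = 1 then i else j) then w s else 0)" for k
      by auto
    show "(\<Sum>k\<leftarrow>?l. map_monomial (incl k) (((\<lambda>_. 0)(Inl i := w 1, Inr j := w 2)) (if s = 1 then Inl k else Inr k)))
        = map_monomial (incl (if s = 1 then i else j)) (w s)"
      unfolding v by (rule s)
  qed
  show "regroup (place (Inr j) (Inl i) p) = transport (\<lambda>s. incl (if s = 1 then i else j)) (place 2 1 p)"
    unfolding regroup_def place_def transport_def push_push e
  proof (rule arg_cong[where f = "\<lambda>h. push h p"], rule ext, rule ext)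
    fix w :: "2 \<Rightarrow> 'l monomial" and s :: 2
    have "s = 1 \<or> s = 2" using UNIV_two by auto
    then have v: "((\<lambda>_. 0)(Inr j := w 1, Inl i := w 2)) (if s = 1 then Inl k else Inr k) =
        (if k = (if s = 1 then i else j) then ((\<lambda>_. 0)(2 := w 1, 1 := w 2)) s else 0)" for k
      by auto
    show "(\<Sum>k\<leftarrow>?l. map_monomial (incl k) (((\<lambda>_. 0)(Inr j := w 1, Inl i := w 2)) (if s = 1 then Inl k else Inr k)))
        = map_monomial (incl (if s = 1 then i else j)) (((\<lambda>_. 0)(2 := w 1, 1 := w 2)) s)"
      unfolding v by (rule s)
  qed
qed

lemma (in lie_bialgebra) array_lists:
  fixes c :: "'n::{finite,linorder} \<Rightarrow> 'n \<Rightarrow> 'c" and d :: "'n \<Rightarrow> 'c"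
  assumes r: "\<And>a. r_matrix sc br \<delta> (r a)" and c: "transitive_array c"
  obtains \<rho> where "r_array sc br \<delta> \<rho>"
    "env_eq (power_sc sc) (power_br br) (regroup (array_r r c d)) (tens 1 2 (r_array.blocks \<rho>))"
proof -
  have "\<exists>ts. env_eq sc br (r a) (tens 1 2 ts) \<and> induces sc br \<delta> ts \<and> env_eq sc br (cyb ts ts ts) 0" for a
    using r_matrix_list[OF r] by metis
  \<comment> \<open>One list is fixed for every label, so that equal labels give literally equal
    blocks.\<close>
  then obtain t where t: "\<And>a. env_eq sc br (r a) (tens 1 2 (t a))" "\<And>a. induces sc br \<delta> (t a)"
    "\<And>a. env_eq sc br (cyb (t a) (t a) (t a)) 0"
    by metis
  \<comment> \<open>Read off from \<open>array_r\<close> with the left half first: for i < j the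
    positive term lands in the pair (j, i), the subtracted one lands in (i, j) as -r_21, and
    \<open>d\<close> fills the diagonal.\<close>
  define \<rho> where "\<rho> = (\<lambda>a b. if b < a then t (c b a) else if a < b then negflip sc (t (c a b)) else t (d a))"
  note opp = opposite_negflip[of sc br] opposite_negflip[of sc br, THEN opposite_sym]
  have "r_array sc br \<delta> \<rho>"
  proof unfold_locales
    fix a b
    show "induces sc br \<delta> (\<rho> a b)"
      using t(2) induces_opposite[OF t(2) opp(1)] by (auto simp: \<rho>_def)
    show "env_eq sc br (cyb (\<rho> a b) (\<rho> a b) (\<rho> a b)) 0"
      using t(3) cyb_opposite_self[OF induces_opposite[OF t(2) opp(1)] t(2) t(3) opp(1)] by (auto simp: \<rho>_def)
    show "a \<noteq> b \<Longrightarrow> opposite sc br (\<rho> a b) (\<rho> b a)"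
      using opp by (auto simp: \<rho>_def)
  next
    fix a x b
    have tr: "\<And>i j k. i < j \<Longrightarrow> j < k \<Longrightarrow> c i k = c i j \<or> c i k = c j k"
      using c by (auto simp: transitive_array_def)
    \<comment> \<open>If b lies strictly between a and x, transitivity gives one of the equalities.
      If b is smallest or largest, it may instead equate the labels of \<open>\<rho> a b\<close> and
      \<open>\<rho> b x\<close>, one of which is used as r and the other as -r_21, so they are
      opposite; a = x with b different leads to the same case.\<close>
    show "\<rho> a x = \<rho> a b \<or> \<rho> a x = \<rho> b x \<or> opposite sc br (\<rho> a b) (\<rho> b x)"
      using tr[of a b x] tr[of a x b] tr[of b a x] tr[of b x a] tr[of x a b] tr[of x b a] opp
      by (cases a b rule: linorder_cases; cases b x rule: linorder_cases; cases a x rule: linorder_cases)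
        (auto simp: \<rho>_def)
  qed
  then interpret r_array sc br \<delta> \<rho> .
  have tr: "eqn (transport (\<lambda>s::2. incl (if s = 1 then i else j)) (r a)) (tens 1 2 (map (map_prod (incl i) (incl j)) (t a)))"
    for i j a
    using env_eq_transport_incl[OF t(1)[of a], of "\<lambda>s. if s = 1 then i else j"] by (simp add: transport_tens)
  have tr': "eqn (- transport (\<lambda>s::2. incl (if s = 1 then i else j)) (place 2 1 (r a)))
     (tens 1 2 (map (map_prod (incl i) (incl j)) (negflip sc (t a))))" for i j a
  proof -
    have "env_eq sc br (place (2::2) 1 (r a)) (place 2 1 (tens (1::2) 2 (t a)))"
      by (rule env_eq_place[OF _ t(1)]) simp
    \<comment> \<open>-r_21 is rewritten as the \<open>negflip\<close> list minus a sum that is null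
      because the two lists are opposite.\<close>
    then have "env_eq sc br (- place (2::2) 1 (r a)) (tens (1::2) 2 (negflip sc (t a))
         - (tens (1::2) 2 (negflip sc (t a)) + tens 2 1 (t a)))"
      by (simp add: place_tens env_eq_minus)
    also have "env_eq sc br \<dots> (tens (1::2) 2 (negflip sc (t a)) - 0)"
      by (intro env_eq_diff env_eq_refl opposite_tens opp) simp
    finally show ?thesis
      using env_eq_transport_incl[of _ _ "\<lambda>s. if s = 1 then i else j"]
      by (force simp: transport_minus transport_tens)
  qed
  have reg: "regroup (p + q) = regroup p + regroup q" "regroup (p - q) = regroup p - regroup q"
    "regroup (\<Sum>x\<in>S. f x) = (\<Sum>x\<in>S. regroup (f x))"
    for p q :: "('k, 'l, 'n + 'n) env_power" and S :: "'x set" and f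
    by (simp_all add: regroup_def push_add push_diff push_sum)
  let ?L = "{(i :: 'n, j). i < j}"
  have expand: "regroup (array_r r c d) = (\<Sum>i\<in>UNIV. transport (\<lambda>s::2. incl (if s = 1 then i else i)) (r (d i))) +
     (\<Sum>(i, j)\<in>?L. transport (\<lambda>s::2. incl (if s = 1 then j else i)) (r (c i j)) +
        - transport (\<lambda>s::2. incl (if s = 1 then i else j)) (place 2 1 (r (c i j))))"
    unfolding array_r_def reg(1)
    by (simp only: regroup_def[symmetric] push_add push_diff push_sum case_prod_unfold regroup_place reg)
      simp
  have "eqn (regroup (array_r r c d)) ((\<Sum>i\<in>UNIV. block 1 2 i i) + (\<Sum>(i, j)\<in>?L. block 1 2 j i + block 1 2 i j))"
    unfolding expand
  proof (intro env_eq_add env_eq_sum)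
    fix i
    show "eqn (transport (\<lambda>s::2. incl (if s = 1 then i else i)) (r (d i))) (block 1 2 i i)"
      using tr[of i i "d i"] by (simp add: \<rho>_def)
  next
    fix x assume "x \<in> ?L"
    then obtain i j where x: "x = (i, j)" "i < j" by auto
    have "eqn (transport (\<lambda>s::2. incl (if s = 1 then j else i)) (r (c i j)) +
        - transport (\<lambda>s::2. incl (if s = 1 then i else j)) (place 2 1 (r (c i j)))) (block 1 2 j i + block 1 2 i j)"
      using env_eq_add[OF tr[of j i "c i j"] tr'[of i j "c i j"]] x(2) order_less_not_sym[OF x(2)] by (simp add: \<rho>_def)
    then show "eqn (case x of (i, j) \<Rightarrow> transport (\<lambda>s::2. incl (if s = 1 then j else i)) (r (c i j)) +
        - transport (\<lambda>s::2. incl (if s = 1 then i else j)) (place 2 1 (r (c i j))))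
        (case x of (i, j) \<Rightarrow> block 1 2 j i + block 1 2 i j)" by (simp add: x)
  qed
  moreover have "(\<Sum>i\<in>UNIV. block (1::2) 2 i i) + (\<Sum>(i, j)\<in>?L. block 1 2 j i + block 1 2 i j) = tens 1 2 blocks"
  proof -
    let ?f = "\<lambda>(a, b). block (1::2) 2 a b"
    let ?S = "prod.swap ` ?L" and ?D = "(\<lambda>i. (i, i)) ` (UNIV :: 'n set)"
    have "x \<in> ?L \<union> (?S \<union> ?D)" for x
    proof -
      obtain a b where x: "x = (a, b)" by (cases x)
      have "(a, b) = prod.swap (b, a)" by simp
      then show ?thesis unfolding x by (cases a b rule: linorder_cases) blast+
    qed
    then have U: "UNIV = ?L \<union> (?S \<union> ?D)" by blast
    have disj: "?L \<inter> (?S \<union> ?D) = {}" "?S \<inter> ?D = {}" by auto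
    have "tens 1 2 blocks = sum ?f UNIV"
      by (simp add: tens_blocks sum.cartesian_product)
    then have "tens 1 2 blocks = sum ?f ?L + (sum ?f ?S + sum ?f ?D)"
      by (simp add: U sum.union_disjoint disj)
    moreover have "sum ?f ?S = (\<Sum>(i, j)\<in>?L. block 1 2 j i)"
      by (subst sum.reindex) (auto simp: inj_on_def case_prod_unfold)
    moreover have "sum ?f ?D = (\<Sum>i\<in>UNIV. block 1 2 i i)"
      by (subst sum.reindex) (auto simp: inj_on_def)
    ultimately show ?thesis by (simp add: sum.distrib case_prod_unfold)
  qed
  ultimately show thesis using that[OF \<open>r_array sc br \<delta> \<rho>\<close>] by simp
qed

section \<open>Regular functions as functionals on the enveloping algebra\<close>

definition ract ::
  "('p \<Rightarrow> 'p \<Rightarrow> 'p) \<Rightarrow> ('l \<Rightarrow> ('p \<Rightarrow> 'k) \<Rightarrow> 'k) \<Rightarrow> 'l \<Rightarrow> ('p \<Rightarrow> 'k) \<Rightarrow> ('p \<Rightarrow> 'k)" where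
  "ract mult D x f = (\<lambda>g. D x (\<lambda>h. f (mult h g)))"

text \<open>The iterated coproduct of a word.\<close>

definition cop :: "'l list \<Rightarrow> ('k::field_char_0, 'l, 'i::finite) env_power" where
  "cop w = prod_list (map (\<lambda>x. \<Sum>i\<in>UNIV. emb i x) w)"

text \<open>Common interface to the group and to its power, so that the calculus of translations and
  the pairing with words are developed once and instantiated for both.\<close>

locale regular_functions =
  fixes mult :: "'p \<Rightarrow> 'p \<Rightarrow> 'p" and one :: 'p and B :: "('p \<Rightarrow> 'k::field_char_0) set"
    and sc :: "'k \<Rightarrow> 'l::ab_group_add \<Rightarrow> 'l" and D :: "'l \<Rightarrow> ('p \<Rightarrow> 'k) \<Rightarrow> 'k"
  assumes assoc: "mult (mult p q) s = mult p (mult q s)"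
    and one_left [simp]: "mult one p = p" and one_right [simp]: "mult p one = p"
    and subalgebra: "function_subalgebra B"
    and mult_regular:
      "f \<in> B \<Longrightarrow> \<exists>ts. set ts \<subseteq> B \<times> B \<and> (\<forall>g h. f (mult g h) = (\<Sum>(a, b)\<leftarrow>ts. a g * b h))"
    and D_add: "f \<in> B \<Longrightarrow> D (x + y) f = D x f + D y f"
    and D_scale: "f \<in> B \<Longrightarrow> D (sc a x) f = a * D x f"
    and D_derivation: "point_derivation one B (D x)"
begin

abbreviation L where "L \<equiv> act mult D"
abbreviation R where "R \<equiv> ract mult D"
abbreviation wact where "wact w f \<equiv> foldr L w f"

lemma B_const [intro]: "(\<lambda>_. a) \<in> B"
  and B_add [intro]: "f \<in> B \<Longrightarrow> g \<in> B \<Longrightarrow> f + g \<in> B"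
  and B_mult [intro]: "f \<in> B \<Longrightarrow> g \<in> B \<Longrightarrow> f * g \<in> B"
  using subalgebra by (auto simp: function_subalgebra_def)

lemma B_zero [intro, simp]: "0 \<in> B"
  using B_const[of 0] by (simp add: zero_fun_def)

lemma B_one [intro, simp]: "1 \<in> B"
  using B_const[of 1] by (simp add: one_fun_def)

lemma B_scale [intro]: "f \<in> B \<Longrightarrow> (\<lambda>g. a * f g) \<in> B"
  using B_mult[OF B_const[of a]] by (simp add: times_fun_def)

lemma B_minus [intro]: "f \<in> B \<Longrightarrow> - f \<in> B"
  using B_scale[of f "- 1"] by (simp add: fun_Compl_def)

lemma B_diff [intro]: "f \<in> B \<Longrightarrow> g \<in> B \<Longrightarrow> f - g \<in> B"
  using B_add[of f "- g"] by auto

lemma B_sum_list: "(\<And>x. x \<in> set xs \<Longrightarrow> f x \<in> B) \<Longrightarrow> (\<Sum>x\<leftarrow>xs. f x) \<in> B"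
  by (induction xs) auto

lemma B_sum: "(\<And>x. x \<in> S \<Longrightarrow> f x \<in> B) \<Longrightarrow> (\<Sum>x\<in>S. f x) \<in> B"
  by (induction S rule: infinite_finite_induct) auto

lemma B_prod: "(\<And>x. x \<in> S \<Longrightarrow> f x \<in> B) \<Longrightarrow> (\<Prod>x\<in>S. f x) \<in> B"
  by (induction S rule: infinite_finite_induct) auto

lemma D_fun_add: "f \<in> B \<Longrightarrow> g \<in> B \<Longrightarrow> D x (f + g) = D x f + D x g"
  and D_fun_scale: "f \<in> B \<Longrightarrow> D x (\<lambda>g. a * f g) = a * D x f"
  and D_fun_mult: "f \<in> B \<Longrightarrow> g \<in> B \<Longrightarrow> D x (f * g) = D x f * g one + f one * D x g"
  using D_derivation[of x] by (auto simp: point_derivation_def)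

lemma D_const [simp]: "D x (\<lambda>_. a) = 0"
proof -
  have "D x (1 * 1) = D x 1 + D x 1"
    by (subst D_fun_mult) auto
  then have "D x 1 = 0" by simp
  then have "D x (\<lambda>_. 1) = 0" by (simp add: one_fun_def)
  then show ?thesis using D_fun_scale[of "\<lambda>_. 1" x a] B_const[of 1] by simp
qed

text \<open>\<open>mult_regular\<close> presents a translate of a regular function as such a sum
  with one variable frozen; linearity lets the derivation act under the sum.\<close>

lemma D_expand:
  assumes "set ts \<subseteq> B \<times> B"
  shows "D x (\<lambda>h. \<Sum>(a, b)\<leftarrow>ts. a g * b h) = (\<Sum>(a, b)\<leftarrow>ts. a g * D x b)"
    and "D x (\<lambda>h. \<Sum>(a, b)\<leftarrow>ts. a h * b g) = (\<Sum>(a, b)\<leftarrow>ts. D x a * b g)"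
    and "(\<lambda>h. \<Sum>(a, b)\<leftarrow>ts. a g * b h) \<in> B" "(\<lambda>h. \<Sum>(a, b)\<leftarrow>ts. a h * b g) \<in> B"
proof -
  have "D x (\<lambda>h. \<Sum>(a, b)\<leftarrow>ts. a g * b h) = (\<Sum>(a, b)\<leftarrow>ts. a g * D x b) \<and>
    D x (\<lambda>h. \<Sum>(a, b)\<leftarrow>ts. a h * b g) = (\<Sum>(a, b)\<leftarrow>ts. D x a * b g) \<and>
    (\<lambda>h. \<Sum>(a, b)\<leftarrow>ts. a g * b h) \<in> B \<and> (\<lambda>h. \<Sum>(a, b)\<leftarrow>ts. a h * b g) \<in> B"
    using assms
  proof (induction ts)
    case (Cons t ts)
    obtain a b where t: "t = (a, b)" by (cases t)
    have ab: "a \<in> B" "b \<in> B" and ts: "set ts \<subseteq> B \<times> B" using Cons.prems t by auto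
    have 1: "(\<lambda>h. \<Sum>(a, b)\<leftarrow>t # ts. a g * b h) = (\<lambda>h. a g * b h) + (\<lambda>h. \<Sum>(a, b)\<leftarrow>ts. a g * b h)"
      and 2: "(\<lambda>h. \<Sum>(a, b)\<leftarrow>t # ts. a h * b g) = (\<lambda>h. b g * a h) + (\<lambda>h. \<Sum>(a, b)\<leftarrow>ts. a h * b g)"
      by (auto simp: t fun_eq_iff)
    note IH = Cons.IH[OF ts]
    have sb: "(\<lambda>h. a g * b h) \<in> B" "(\<lambda>h. b g * a h) \<in> B" using ab by auto
    show ?case unfolding 1 2
      using IH ab sb by (simp add: D_fun_add D_fun_scale B_add t)
  qed (auto simp: D_const)
  then show "D x (\<lambda>h. \<Sum>(a, b)\<leftarrow>ts. a g * b h) = (\<Sum>(a, b)\<leftarrow>ts. a g * D x b)"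
    and "D x (\<lambda>h. \<Sum>(a, b)\<leftarrow>ts. a h * b g) = (\<Sum>(a, b)\<leftarrow>ts. D x a * b g)"
    and "(\<lambda>h. \<Sum>(a, b)\<leftarrow>ts. a g * b h) \<in> B" "(\<lambda>h. \<Sum>(a, b)\<leftarrow>ts. a h * b g) \<in> B"
    by blast+
qed

lemma translate_left: "f \<in> B \<Longrightarrow> (\<lambda>h. f (mult g h)) \<in> B"
  and translate_right: "f \<in> B \<Longrightarrow> (\<lambda>h. f (mult h g)) \<in> B"
proof -
  assume "f \<in> B"
  then obtain ts where ts: "set ts \<subseteq> B \<times> B" "\<And>g h. f (mult g h) = (\<Sum>(a, b)\<leftarrow>ts. a g * b h)"
    using mult_regular by metis
  show "(\<lambda>h. f (mult g h)) \<in> B" "(\<lambda>h. f (mult h g)) \<in> B"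
    unfolding ts(2) using D_expand(3,4)[OF ts(1)] by auto
qed

lemma L_in [intro]: "f \<in> B \<Longrightarrow> L x f \<in> B"
  and R_in [intro]: "f \<in> B \<Longrightarrow> R x f \<in> B"
  and L_R: "f \<in> B \<Longrightarrow> L x (R y f) = R y (L x f)"
proof -
  assume "f \<in> B"
  then obtain ts where ts: "set ts \<subseteq> B \<times> B" "\<And>g h. f (mult g h) = (\<Sum>(a, b)\<leftarrow>ts. a g * b h)"
    using mult_regular by metis
  have L: "L x f = (\<lambda>g. \<Sum>(a, b)\<leftarrow>ts. a g * D x b)" for x
    by (simp add: act_def ts(2) D_expand[OF ts(1)])
  have R: "R x f = (\<lambda>g. \<Sum>(a, b)\<leftarrow>ts. D x a * b g)" for x
    by (simp add: ract_def ts(2) D_expand[OF ts(1)])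
  have "set (map (\<lambda>(a, b). (a, \<lambda>_. D x b)) ts) \<subseteq> B \<times> B" "set (map (\<lambda>(a, b). (\<lambda>_. D x a, b)) ts) \<subseteq> B \<times> B" for x
    using ts(1) by auto
  note * = D_expand(4)[OF this(1)] D_expand(3)[OF this(2)]
  show "L x f \<in> B" "R x f \<in> B"
    using * by (simp_all add: L R o_def case_prod_unfold)
  have "set (map (\<lambda>(a, b). (\<lambda>_. D y a, \<lambda>h. b (mult g h))) ts) \<subseteq> B \<times> B" for g
  proof -
    have "\<And>a b. (a, b) \<in> set ts \<Longrightarrow> b \<in> B" using ts(1) by auto
    moreover have "b \<in> B \<Longrightarrow> (\<lambda>h. b (mult g h)) \<in> B" for b
    proof -
      assume "b \<in> B"
      then obtain us where us: "set us \<subseteq> B \<times> B" "\<And>g h. b (mult g h) = (\<Sum>(a, b)\<leftarrow>us. a g * b h)"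
        using mult_regular by metis
      show ?thesis unfolding us(2) using D_expand(3)[OF us(1)] by auto
    qed
    ultimately show ?thesis by auto
  qed
  \<comment> \<open>The first components are constant functions here, so the point at which they are
    evaluated is immaterial.\<close>
  note D1 = D_expand(1)[OF this, of x undefined]
  have "L x (R y f) g = (\<Sum>(a, b)\<leftarrow>ts. D y a * L x b g)" for g
    using D1 by (simp add: R act_def o_def case_prod_unfold)
  moreover have "R y (L x f) g = (\<Sum>(a, b)\<leftarrow>ts. D y a * L x b g)" for g
  proof -
    have "L x f (mult k g) = (\<Sum>(a, b)\<leftarrow>ts. a k * L x b g)" for k
    proof -
      have "f (mult (mult k g) h) = (\<Sum>(a, b)\<leftarrow>map (\<lambda>(a, b). (a, \<lambda>h. b (mult g h))) ts. a k * b h)" for h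
        by (simp add: assoc ts(2) o_def case_prod_unfold)
      moreover have "set (map (\<lambda>(a, b). (a, \<lambda>h. b (mult g h))) ts) \<subseteq> B \<times> B"
        using ts(1) translate_left by auto
      from D_expand(1)[OF this, of x k]
      have "D x (\<lambda>h. \<Sum>(a, b)\<leftarrow>map (\<lambda>(a, b). (a, \<lambda>h. b (mult g h))) ts. a k * b h) = (\<Sum>(a, b)\<leftarrow>ts. a k * L x b g)"
        by (simp add: act_def o_def case_prod_unfold)
      ultimately show ?thesis by (simp add: act_def)
    qed
    moreover have "set (map (\<lambda>(a, b). (a, \<lambda>_. L x b g)) ts) \<subseteq> B \<times> B" using ts(1) by auto
    from D_expand(2)[OF this, of y g]
    have "D y (\<lambda>k. \<Sum>(a, b)\<leftarrow>ts. a k * L x b g) = (\<Sum>(a, b)\<leftarrow>ts. D y a * L x b g)"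
      by (simp add: o_def case_prod_unfold)
    ultimately show ?thesis by (simp add: ract_def)
  qed
  ultimately show "L x (R y f) = R y (L x f)" by (auto simp: fun_eq_iff)
qed

lemma L_add: "f \<in> B \<Longrightarrow> g \<in> B \<Longrightarrow> L x (f + g) = L x f + L x g"
  using D_fun_add[OF translate_left translate_left] by (simp add: act_def fun_eq_iff plus_fun_def)

lemma R_add: "f \<in> B \<Longrightarrow> g \<in> B \<Longrightarrow> R x (f + g) = R x f + R x g"
  using D_fun_add[OF translate_right translate_right] by (simp add: ract_def fun_eq_iff plus_fun_def)

lemma L_mult: "f \<in> B \<Longrightarrow> g \<in> B \<Longrightarrow> L x (f * g) = L x f * g + f * L x g"
  using D_fun_mult[OF translate_left translate_left] by (simp add: act_def fun_eq_iff times_fun_def)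

lemma R_mult: "f \<in> B \<Longrightarrow> g \<in> B \<Longrightarrow> R x (f * g) = R x f * g + f * R x g"
  using D_fun_mult[OF translate_right translate_right] by (simp add: ract_def fun_eq_iff times_fun_def)

lemma L_const [simp]: "L x (\<lambda>_. a) = 0"
  by (simp add: act_def zero_fun_def)

lemma R_const [simp]: "R x (\<lambda>_. a) = 0"
  by (simp add: ract_def zero_fun_def)

lemma L_zero [simp]: "L x 0 = 0" and R_zero [simp]: "R x 0 = 0"
  and L_one [simp]: "L x 1 = 0"
  using L_const[of x 0] R_const[of x 0] L_const[of x 1]
  by (simp_all only: zero_fun_def one_fun_def)

lemma L_scale: "f \<in> B \<Longrightarrow> L x ((\<lambda>_. a) * f) = (\<lambda>_. a) * L x f"
  by (simp add: L_mult B_const)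

lemma R_scale: "f \<in> B \<Longrightarrow> R x ((\<lambda>_. a) * f) = (\<lambda>_. a) * R x f"
  by (simp add: R_mult B_const)

lemma L_minus: "f \<in> B \<Longrightarrow> L x (- f) = - L x f"
  using L_add[of f "- f" x] by (simp add: B_minus add_eq_0_iff)

lemma L_diff: "f \<in> B \<Longrightarrow> g \<in> B \<Longrightarrow> L x (f - g) = L x f - L x g"
  using L_add[of f "- g" x] by (simp add: B_minus L_minus)

lemma L_add_index: "f \<in> B \<Longrightarrow> L (x + y) f = L x f + L y f"
  by (simp add: act_def fun_eq_iff D_add translate_left)

lemma L_scale_index: "f \<in> B \<Longrightarrow> L (sc a x) f = (\<lambda>_. a) * L x f"
  by (simp add: act_def fun_eq_iff D_scale translate_left)

lemma wact_in [intro]: "f \<in> B \<Longrightarrow> wact w f \<in> B"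
  by (induction w) auto

lemma wact_add: "f \<in> B \<Longrightarrow> g \<in> B \<Longrightarrow> wact w (f + g) = wact w f + wact w g"
  by (induction w) (auto simp: L_add wact_in)

lemma wact_diff: "f \<in> B \<Longrightarrow> g \<in> B \<Longrightarrow> wact w (f - g) = wact w f - wact w g"
  by (induction w) (auto simp: L_diff wact_in)

lemma wact_scale: "f \<in> B \<Longrightarrow> wact w ((\<lambda>_. a) * f) = (\<lambda>_. a) * wact w f"
  by (induction w) (auto simp: L_scale wact_in)

lemma wact_zero [simp]: "wact w 0 = 0"
  by (induction w) auto

lemma wact_sum: "(\<And>x. x \<in> S \<Longrightarrow> f x \<in> B) \<Longrightarrow> wact w (\<Sum>x\<in>S. f x) = (\<Sum>x\<in>S. wact w (f x))"
  by (induction S rule: infinite_finite_induct) (auto simp: wact_add B_sum)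

lemma wact_sum_list: "(\<And>x. x \<in> set xs \<Longrightarrow> f x \<in> B) \<Longrightarrow> wact w (\<Sum>x\<leftarrow>xs. f x) = (\<Sum>x\<leftarrow>xs. wact w (f x))"
  by (induction xs) (auto simp: wact_add B_sum_list)

lemma wact_R: "f \<in> B \<Longrightarrow> wact w (R x f) = R x (wact w f)"
  by (induction w) (auto simp: L_R wact_in)

text \<open>\<open>R x\<close> commutes with every \<open>L y\<close>, and at the identity
  \<open>R x\<close> and \<open>L x\<close> both reduce to \<open>D x\<close>. So \<open>R x\<close>
  on a function amounts to prefixing a letter, whereas \<open>L x\<close> amounts to appending
  one.\<close>

lemma wact_R_one: "f \<in> B \<Longrightarrow> wact w (R x f) one = wact (x # w) f one"
  by (simp add: wact_R) (simp add: act_def ract_def)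

lemma L_prod:
  assumes "finite S" "\<And>i. i \<in> S \<Longrightarrow> F i \<in> B"
  shows "L x (\<Prod>i\<in>S. F i) = (\<Sum>i\<in>S. \<Prod>j\<in>S. (F(i := L x (F i))) j)"
  using assms
proof (induction S rule: finite_induct)
  case (insert k S)
  have "L x (\<Prod>i\<in>insert k S. F i) = L x (F k) * prod F S + F k * L x (prod F S)"
    using insert by (simp add: L_mult B_prod)
  also have "L x (prod F S) = (\<Sum>i\<in>S. \<Prod>j\<in>S. (F(i := L x (F i))) j)"
    using insert by simp
  also have "F k * \<dots> = (\<Sum>i\<in>S. \<Prod>j\<in>insert k S. (F(i := L x (F i))) j)"
    unfolding sum_distrib_left
  proof (rule sum.cong[OF refl])
    fix i assume "i \<in> S"
    then show "F k * (\<Prod>j\<in>S. (F(i := L x (F i))) j) = (\<Prod>j\<in>insert k S. (F(i := L x (F i))) j)"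
      using insert by auto
  qed
  also have "L x (F k) * prod F S = (\<Prod>j\<in>insert k S. (F(k := L x (F k))) j)"
  proof -
    have "prod F S = prod (F(k := L x (F k))) S"
      by (rule prod.cong) (use insert.hyps in auto)
    then show ?thesis using insert.hyps by simp
  qed
  finally show ?case using insert by simp
qed simp

text \<open>The pairing of the tensor product of the functions \<open>F i\<close> with the tensor power of the enveloping algebra.\<close>

definition evl :: "('i::finite \<Rightarrow> 'p \<Rightarrow> 'k) \<Rightarrow> ('k, 'l, 'i) env_power \<Rightarrow> 'k" where
  "evl F = lin (\<lambda>w. \<Prod>i\<in>UNIV. wact (letters (w i)) (F i) one)"

lemma evl_add: "evl F (p + q) = evl F p + evl F q"
  and evl_diff: "evl F (p - q) = evl F p - evl F q"
  and evl_zero [simp]: "evl F 0 = 0"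
  and evl_sum: "evl F (\<Sum>x\<in>S. f x) = (\<Sum>x\<in>S. evl F (f x))"
  by (simp_all add: evl_def lin_add lin_diff lin_minus lin_sum lin_sum_list)

lemma letters_plus [simp]: "letters (u + v) = letters u @ letters v"
  by (simp add: plus_monomial_def)

lemma letters_zero [simp]: "letters 0 = []"
  by (simp add: zero_monomial_def)

lemma evl_one [simp]: "evl F 1 = (\<Prod>i\<in>UNIV. F i one)"
  by (simp add: evl_def flip: single_one)

text \<open>A letter appended to the word in factor i is the first one to act on
  \<open>F i\<close>.\<close>

lemma evl_mult_emb: "evl F (q * emb i x) = evl (F(i := L x (F i))) q"
proof (induction q rule: poly_mapping_induct_single)
  case (single u a)
  have "(\<Prod>j\<in>UNIV. wact (letters ((u + (\<lambda>_. 0)(i := Monomial [x])) j)) (F j) one) =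
    (\<Prod>j\<in>UNIV. wact (letters (u j)) ((F(i := L x (F i))) j) one)"
    by (rule prod.cong) auto
  then show ?case by (simp add: evl_def emb_def mult_single)
qed (simp add: distrib_right evl_add)

lemma evl_emb_mult:
  assumes "F i \<in> B"
  shows "evl F (emb i x * q) = evl (F(i := R x (F i))) q"
proof (induction q rule: poly_mapping_induct_single)
  case (single u a)
  have "(\<Prod>j\<in>UNIV. wact (letters (((\<lambda>_. 0)(i := Monomial [x]) + u) j)) (F j) one) =
    (\<Prod>j\<in>UNIV. wact (letters (u j)) ((F(i := R x (F i))) j) one)"
    by (rule prod.cong) (use assms in \<open>auto simp: wact_R_one\<close>)
  then show ?case by (simp add: evl_def emb_def mult_single)
qed (simp add: distrib_left evl_add)

lemma evl_tens_mult:
  assumes "i \<noteq> j" "F i \<in> B" "F j \<in> B"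
  shows "evl F (tens i j ts * q) = (\<Sum>(a, b)\<leftarrow>ts. evl (F(i := R a (F i), j := R b (F j))) q)"
proof (induction ts)
  case (Cons t ts)
  obtain a b where t: "t = (a, b)" by (cases t)
  have "evl F (emb i a * (emb j b * q)) = evl (F(i := R a (F i), j := R b (F j))) q"
    using assms by (subst evl_emb_mult, simp, subst evl_emb_mult) auto
  then show ?case using Cons by (simp add: t distrib_right evl_add mult.assoc fun_upd_def)
qed simp

lemma evl_mult_tens:
  assumes "i \<noteq> j"
  shows "evl F (q * tens i j ts) = (\<Sum>(a, b)\<leftarrow>ts. evl (F(i := L a (F i), j := L b (F j))) q)"
proof (induction ts)
  case (Cons t ts)
  obtain a b where t: "t = (a, b)" by (cases t)
  have "evl F (q * emb i a * emb j b) = evl (F(i := L a (F i), j := L b (F j))) q"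
    using assms by (simp add: evl_mult_emb fun_upd_twist)
  then show ?case using Cons by (simp add: t distrib_left evl_add mult.assoc fun_upd_def)
qed simp

text \<open>The product rule, letter by letter: multiplication of functions is dual to the iterated
  coproduct.\<close>

lemma wact_prod:
  assumes "\<And>i. F i \<in> B"
  shows "wact w (\<Prod>i\<in>UNIV. F i) one = evl F (cop w)"
  using assms
\<comment> \<open>The last letter acts first, and its product rule changes one of the functions, so
  \<open>F\<close> has to vary.\<close>
proof (induction w arbitrary: F rule: rev_induct)
  case Nil
  have "(\<Prod>i\<in>S. F i) one = (\<Prod>i\<in>S. F i one)" for S
    by (induction S rule: infinite_finite_induct) auto
  then show ?case by (simp add: cop_def)
next
  case (snoc x w)
  have "wact (w @ [x]) (\<Prod>i\<in>UNIV. F i) one = wact w (\<Sum>i\<in>UNIV. \<Prod>j\<in>UNIV. (F(i := L x (F i))) j) one"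
    using snoc.prems by (simp add: L_prod)
  also have "\<dots> = (\<Sum>i\<in>UNIV. wact w (\<Prod>j\<in>UNIV. (F(i := L x (F i))) j)) one"
    by (subst wact_sum) (use snoc.prems in \<open>auto intro!: B_prod L_in\<close>)
  also have "\<dots> = (\<Sum>i\<in>UNIV. evl (F(i := L x (F i))) (cop w))"
    unfolding sum_fun_apply
    by (rule sum.cong[OF refl], rule snoc.IH) (use snoc.prems in \<open>auto intro!: L_in\<close>)
  also have "\<dots> = evl F (cop (w @ [x]))"
    by (simp add: cop_def sum_distrib_left evl_sum evl_mult_emb)
  finally show ?case .
qed

end

locale group_functions = regular_functions mult one B sc D
  for mult :: "'p \<Rightarrow> 'p \<Rightarrow> 'p" and one :: 'p and B :: "('p \<Rightarrow> 'k::field_char_0) set"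
    and sc :: "'k \<Rightarrow> 'l::ab_group_add \<Rightarrow> 'l" and D :: "'l \<Rightarrow> ('p \<Rightarrow> 'k) \<Rightarrow> 'k" +
  fixes br :: "'l \<Rightarrow> 'l \<Rightarrow> 'l"
  assumes D_bracket: "f \<in> B \<Longrightarrow> D (br x y) f = D x (act mult D y f) - D y (act mult D x f)"
    and inj_dual: "inj_on (to_dual mult one D) B"
begin

lemma L_bracket:
  assumes "f \<in> B"
  shows "L (br x y) f = L x (L y f) - L y (L x f)"
  using D_bracket[OF translate_left[OF assms]] by (simp add: act_def fun_eq_iff assoc)

text \<open>The test behind the function identities below: words span the representatives, so
  injectivity of \<open>to_dual\<close> can be read on words.\<close>

lemma wact_inj:
  assumes "f \<in> B" "\<And>w. wact w f one = 0"
  shows "f = 0"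
proof (rule inj_onD[OF inj_dual])
  have "to_dual mult one D 0 = to_dual mult one D f"
    using assms(2) by (simp add: to_dual_def)
  then show "to_dual mult one D f = to_dual mult one D 0" ..
qed (use assms in auto)

text \<open>Only factor i, where the relation sits, is affected; the others contribute the constant
  \<open>K i\<close>. In factor i the relation becomes additivity, homogeneity or the bracket rule
  of \<open>L\<close>, between two fixed words.\<close>

lemma evl_relation:
  assumes F: "\<And>i. F i \<in> B" and e: "e \<in> env_relations sc br"
  shows "evl F (Poly_Mapping.single u a * e * Poly_Mapping.single v b) = 0"
proof -
  define W where "W i xs = wact (letters (u i) @ xs @ letters (v i)) (F i) one" for i xs
  define K where "K i = (\<Prod>j\<in>UNIV - {i}. wact (letters (u j) @ letters (v j)) (F j) one)" for i
  have ev: "evl F (Poly_Mapping.single u a * Poly_Mapping.single ((\<lambda>_. 0)(i := Monomial xs)) c * Poly_Mapping.single v b)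
    = a * c * b * (K i * W i xs)" for i xs c
  proof -
    have "(\<Prod>j\<in>UNIV. wact (letters ((u + (\<lambda>_. 0)(i := Monomial xs) + v) j)) (F j) one) =
       wact (letters ((u + (\<lambda>_. 0)(i := Monomial xs) + v) i)) (F i) one *
       (\<Prod>j\<in>UNIV-{i}. wact (letters ((u + (\<lambda>_. 0)(i := Monomial xs) + v) j)) (F j) one)"
      by (rule prod.remove) auto
    also have "\<dots> = W i xs * K i"
      unfolding W_def K_def by (intro arg_cong2[where f = "(*)"] prod.cong) auto
    finally show ?thesis by (simp add: evl_def mult_single)
  qed
  have emb2: "emb i x * emb i y = Poly_Mapping.single ((\<lambda>_. 0)(i := Monomial [x, y])) (1 :: 'k)" for i :: 'b and x y
    by (auto simp: emb_def mult_single fun_eq_iff plus_monomial_def zero_monomial_def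
      intro!: arg_cong[where f = "\<lambda>w. Poly_Mapping.single w _"])
  have emb_sc: "scalar c * emb i x = Poly_Mapping.single ((\<lambda>_. 0)(i := Monomial [x])) (c :: 'k)" for i :: 'b and x c
    by (simp add: emb_def mult_single)
  have Wu: "W i xs = wact (letters (u i)) (wact xs (wact (letters (v i)) (F i))) one" for i xs
    by (simp add: W_def)
  have vB: "wact (letters (v i)) (F i) \<in> B" for i using F by auto
  have W_add: "W i [x + y] = W i [x] + W i [y]" for i x y
    unfolding Wu using vB[of i] by (simp add: L_add_index wact_add L_in)
  have W_sc: "W i [sc c x] = c * W i [x]" for i x c
    unfolding Wu using vB[of i] by (simp add: L_scale_index wact_scale L_in)
  have W_br: "W i [br x y] = W i [x, y] - W i [y, x]" for i x y
    unfolding Wu using vB[of i] by (simp add: L_bracket wact_diff L_in)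
  note dist = ring_distribs evl_add evl_diff
  from e consider
    i x y where "e = emb i (x + y) - emb i x - emb i y" |
    i c x where "e = emb i (sc c x) - scalar c * emb i x" |
    i x y where "e = emb i x * emb i y - emb i y * emb i x - emb i (br x y)"
    unfolding env_relations_def by blast
  then show ?thesis
  proof cases
    case (1 i x y)
    show ?thesis unfolding 1 emb_def dist ev W_add by (simp add: algebra_simps)
  next
    case (2 i c x)
    show ?thesis unfolding 2 emb_sc unfolding emb_def dist ev W_sc by (simp add: algebra_simps)
  next
    case (3 i x y)
    show ?thesis unfolding 3 emb2 unfolding emb_def dist ev W_br by (simp add: algebra_simps)
  qed
qed

text \<open>Makes the pairing well defined on the tensor power of the enveloping algebra; linearity
  reduces the coefficients of an ideal element to monomials.\<close>

lemma evl_env_eq: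
  assumes F: "\<And>i. F i \<in> B" and pq: "env_eq sc br p q"
  shows "evl F p = evl F q"
proof -
  have "evl F a = 0" if "a \<in> two_sided_ideal (env_relations sc br)" for a
    using that
  proof (induction rule: two_sided_ideal.induct)
    case (gen e u v)
    show ?case
    proof (induction u rule: poly_mapping_induct_single)
      case (single u a)
      show ?case
        by (induction v rule: poly_mapping_induct_single)
          (simp_all add: evl_relation[OF F gen] distrib_left evl_add)
    qed (simp add: distrib_right evl_add)
  qed (auto simp: evl_add)
  from this[of "p - q"] show ?thesis using pq by (simp add: env_eq_def evl_diff)
qed

end

section \<open>The Poisson bracket of an r-matrix\<close>

text \<open>To be read with x, y, z = r_12, r_13, r_23, primes for their flips, and w the coproduct
  of a word. Apart from the Yang-Baxter term, each summand on the right contains a symmetrized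
  r-matrix, paired with w or, in the first summand, with r_23 + r_21.\<close>

lemma commutator_jacobi_cyclic:
  fixes x y z :: "'a::ring"
  shows "commutator z (commutator (x + y) w) + commutator y' (commutator (z + x') w) + commutator x (commutator (y' + z') w) =
    commutator (commutator (y + y') (z + x')) w + commutator (z + x') (commutator (y + y') w)
    - commutator y (commutator (x + x') w) + commutator x (commutator (y + y') w) + commutator x (commutator (z + z') w)
    - commutator (commutator x y + commutator x z + commutator y z) w"
  by (simp add: commutator_def algebra_simps)

lemma sum_list_fun_apply: "(\<Sum>x\<leftarrow>xs. f x) y = (\<Sum>x\<leftarrow>xs. f x y)"
  by (induction xs) auto

text \<open>Interpreted for the group with the list of one r-matrix and for the power with the list
  of blocks. \<open>invariant\<close> is a separate assumption because it comes from skewness of the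
  cobracket in the first case and from a computation with blocks in the second.\<close>

locale poisson_group = group_functions mult one B sc D br
  for mult :: "'p \<Rightarrow> 'p \<Rightarrow> 'p" and one :: 'p and B :: "('p \<Rightarrow> 'k::field_char_0) set"
    and sc :: "'k \<Rightarrow> 'l::ab_group_add \<Rightarrow> 'l" and D :: "'l \<Rightarrow> ('p \<Rightarrow> 'k) \<Rightarrow> 'k" and br +
  fixes \<delta> :: "'l \<Rightarrow> ('k, 'l, 2) env_power" and ts :: "('l \<times> 'l) list"
  assumes induces: "induces sc br \<delta> ts"
    and invariant: "env_eq sc br (commutator (tens 1 2 ts + tens 2 1 ts) (coprod x)) 0"
    and yang_baxter: "env_eq sc br (cyb ts ts ts) 0"
begin

definition pb :: "('p \<Rightarrow> 'k) \<Rightarrow> ('p \<Rightarrow> 'k) \<Rightarrow> 'p \<Rightarrow> 'k" where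
  "pb f g = (\<Sum>(a, b)\<leftarrow>ts. R a f * R b g - L a f * L b g)"

lemma pb_in [intro]: "f \<in> B \<Longrightarrow> g \<in> B \<Longrightarrow> pb f g \<in> B"
  unfolding pb_def by (rule B_sum_list) auto

lemma pb_add:
  assumes "f \<in> B" "g \<in> B" "h \<in> B"
  shows "pb (f + g) h = pb f h + pb g h" "pb h (f + g) = pb h f + pb h g"
  unfolding pb_def sum_list_addf[symmetric]
  by (intro arg_cong[where f = sum_list] map_cong refl; use assms in \<open>auto simp: L_add R_add algebra_simps\<close>)+

lemma pb_scale:
  assumes "f \<in> B" "g \<in> B"
  shows "pb ((\<lambda>_. a) * f) g = (\<lambda>_. a) * pb f g" "pb f ((\<lambda>_. a) * g) = (\<lambda>_. a) * pb f g"
  unfolding pb_def sum_list_const_mult[symmetric]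
  by (intro arg_cong[where f = sum_list] map_cong refl; use assms in \<open>auto simp: L_scale R_scale right_diff_distrib mult.assoc mult.left_commute[of _ "\<lambda>_. a"]\<close>)+

lemma pb_mult:
  assumes "f \<in> B" "g \<in> B" "h \<in> B"
  shows "pb f (g * h) = pb f g * h + g * pb f h"
  unfolding pb_def sum_list_const_mult[symmetric] sum_list_mult_const[symmetric] sum_list_addf[symmetric]
  by (intro arg_cong[where f = sum_list] map_cong refl; use assms in \<open>auto simp: L_mult R_mult algebra_simps\<close>)

lemma pb_zero: "f \<in> B \<Longrightarrow> pb f 0 = 0"
  using pb_add(2)[of 0 0 f] by simp

lemma pb_diff: "f \<in> B \<Longrightarrow> g \<in> B \<Longrightarrow> h \<in> B \<Longrightarrow> pb h (f - g) = pb h f - pb h g"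
  using pb_add(2)[of "f - g" g h] by (simp add: B_diff)

lemma pb_sum_list: "h \<in> B \<Longrightarrow> (\<And>x. x \<in> set xs \<Longrightarrow> f x \<in> B) \<Longrightarrow> pb h (\<Sum>x\<leftarrow>xs. f x) = (\<Sum>x\<leftarrow>xs. pb h (f x))"
  by (induction xs) (auto simp: pb_zero pb_add B_sum_list)

lemma evl_commutator_tens:
  assumes "i \<noteq> j" "F i \<in> B" "F j \<in> B"
  shows "evl F (commutator (tens i j us) q) =
    (\<Sum>(a, b)\<leftarrow>us. evl (F(i := R a (F i), j := R b (F j))) q - evl (F(i := L a (F i), j := L b (F j))) q)"
  using assms by (simp add: commutator_def evl_diff evl_tens_mult evl_mult_tens sum_list_subtractf case_prod_unfold)

lemma evl_cop_pair:
  fixes F :: "2 \<Rightarrow> 'p \<Rightarrow> 'k"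
  assumes "\<And>i. F i \<in> B"
  shows "evl F (cop w) = wact w (F 1 * F 2) one"
  using wact_prod[of F w] assms by (simp add: UNIV_two)

lemma evl_cop_triple:
  assumes "\<And>i. F i \<in> B" and U: "UNIV = {i, j, k}" "i \<noteq> j" "i \<noteq> k" "j \<noteq> k"
  shows "evl F (cop w) = wact w (F i * (F j * F k)) one"
  unfolding wact_prod[OF assms(1), symmetric] U(1) using U(2-4) by simp

text \<open>The terms with \<open>R\<close> come from r to the left of the coproduct, those with
  \<open>L\<close> from r to its right; so the bracket of functions is the transpose of the
  commutator with r.\<close>

lemma wact_pb:
  assumes F: "\<And>i. F i \<in> B"
  shows "wact w (pb (F 1) (F 2)) one = evl F (commutator (tens (1::2) 2 ts) (cop w))"
proof -
  have "wact w (pb (F 1) (F 2)) one =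
    (\<Sum>(a, b)\<leftarrow>ts. wact w (R a (F 1) * R b (F 2)) one - wact w (L a (F 1) * L b (F 2)) one)"
  proof -
    have "wact w (pb (F 1) (F 2)) = (\<Sum>(a, b)\<leftarrow>ts. wact w (R a (F 1) * R b (F 2)) - wact w (L a (F 1) * L b (F 2)))"
      unfolding pb_def using F
      by (subst wact_sum_list) (auto simp: case_prod_unfold wact_diff B_mult R_in L_in)
    then show ?thesis by (simp add: case_prod_unfold sum_list_fun_apply)
  qed
  also have "\<dots> = evl F (commutator (tens (1::2) 2 ts) (cop w))"
    using F
    by (subst evl_commutator_tens, simp, simp, simp, intro arg_cong[where f = sum_list] map_cong)
      (auto simp: evl_cop_pair R_in L_in)
  finally show ?thesis .
qed

context
  fixes i j k :: "3"
  assumes U: "UNIV = {i, j, k}" "i \<noteq> j" "i \<noteq> k" "j \<noteq> k"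
begin

text \<open>By the product rule the second leg of r falls on \<open>F j\<close> or on
  \<open>F k\<close>, which gives r_ij + r_ik. Products appear because an inner bracket is a sum of
  products.\<close>

lemma wact_pb_mult:
  assumes F: "\<And>i. F i \<in> B"
  shows "wact w (pb (F i) (F j * F k)) one = evl F (commutator (tens i j ts + tens i k ts) (cop w))"
proof -
  have "wact w (pb (F i) (F j * F k)) one =
    (\<Sum>(a, b)\<leftarrow>ts. wact w (R a (F i) * (R b (F j) * F k)) one - wact w (L a (F i) * (L b (F j) * F k)) one) +
    (\<Sum>(a, b)\<leftarrow>ts. wact w (R a (F i) * (F j * R b (F k))) one - wact w (L a (F i) * (F j * L b (F k))) one)"
  proof -
    have 1: "pb (F i) (F j * F k) = (\<Sum>(a, b)\<leftarrow>ts. R a (F i) * (R b (F j) * F k) - L a (F i) * (L b (F j) * F k)) +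
       (\<Sum>(a, b)\<leftarrow>ts. R a (F i) * (F j * R b (F k)) - L a (F i) * (F j * L b (F k)))"
      unfolding pb_def sum_list_addf[symmetric]
      by (intro arg_cong[where f = sum_list] map_cong refl) (use F in \<open>auto simp: L_mult R_mult algebra_simps\<close>)
    have "wact w (pb (F i) (F j * F k)) =
       (\<Sum>(a, b)\<leftarrow>ts. wact w (R a (F i) * (R b (F j) * F k)) - wact w (L a (F i) * (L b (F j) * F k))) +
       (\<Sum>(a, b)\<leftarrow>ts. wact w (R a (F i) * (F j * R b (F k))) - wact w (L a (F i) * (F j * L b (F k))))"
      unfolding 1 using F by (subst wact_add)
        (auto intro!: B_sum_list simp: wact_sum_list case_prod_unfold wact_diff B_mult R_in L_in B_diff)
    then show ?thesis by (simp add: case_prod_unfold sum_list_fun_apply)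
  qed
  also have "\<dots> = evl F (commutator (tens i j ts) (cop w)) + evl F (commutator (tens i k ts) (cop w))"
    using F U(2,3,4) U(2,3,4)[symmetric]
    by (simp add: evl_commutator_tens evl_cop_triple[OF _ U] R_in L_in)
  finally show ?thesis by (simp add: commutator_add_left evl_add)
qed

text \<open>Transposition reverses the order: the inner bracket changes \<open>F j\<close> and
  \<open>F k\<close> and becomes the outer commutator.\<close>

lemma wact_pb_pb:
  assumes F: "\<And>i. F i \<in> B"
  shows "wact w (pb (F i) (pb (F j) (F k))) one =
    evl F (commutator (tens j k ts) (commutator (tens i j ts + tens i k ts) (cop w)))"
proof -
  have G: "wact w (pb (F i) (g * h)) one = evl (F(j := g, k := h)) (commutator (tens i j ts + tens i k ts) (cop w))"
    if "g \<in> B" "h \<in> B" for g h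
    using wact_pb_mult[of "F(j := g, k := h)" w] F that U by simp
  have 1: "pb (F i) (pb (F j) (F k)) =
    (\<Sum>(a, b)\<leftarrow>ts. pb (F i) (R a (F j) * R b (F k)) - pb (F i) (L a (F j) * L b (F k)))"
    unfolding pb_def[of "F j"] using F
    by (subst pb_sum_list) (auto simp: case_prod_unfold pb_diff B_mult R_in L_in B_diff)
  have 2: "wact w (pb (F i) (pb (F j) (F k))) = (\<Sum>(a, b)\<leftarrow>ts. wact w (pb (F i) (R a (F j) * R b (F k))) - wact w (pb (F i) (L a (F j) * L b (F k))))"
    unfolding 1
    using F by (subst wact_sum_list) (auto simp: case_prod_unfold wact_diff B_mult R_in L_in pb_in B_diff)
  show ?thesis using F U(4)
    by (simp add: 2 case_prod_unfold sum_list_fun_apply G R_in L_in evl_commutator_tens)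
qed

end

lemma commutator_cop_null:
  assumes "\<And>x. env_eq sc br (commutator t (\<Sum>i\<in>UNIV. emb i x)) 0"
  shows "env_eq sc br (commutator t (cop w)) 0"
  unfolding cop_def by (intro commutator_prod_list_null assms)

lemma pb_self:
  assumes f: "f \<in> B"
  shows "pb f f = 0"
proof (rule wact_inj)
  fix w
  let ?F = "\<lambda>_::2. f"
  let ?s = "tens 1 2 ts + tens 2 1 ts :: ('k, 'l, 2) env_power"
  \<comment> \<open>Both slots hold \<open>f\<close> and functions commute, so flipping r does not
    change the pairing.\<close>
  have sw: "evl ?F (commutator (tens 2 1 ts) (cop w)) = evl ?F (commutator (tens 1 2 ts) (cop w))"
    using f by (auto simp: evl_commutator_tens evl_cop_pair R_in L_in mult.commute)
  have "env_eq sc br (commutator ?s (cop w)) 0"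
    by (rule commutator_cop_null) (use invariant in \<open>simp add: UNIV_two coprod_def\<close>)
  then have "evl ?F (commutator ?s (cop w)) = evl ?F 0"
    using f by (intro evl_env_eq) auto
  \<comment> \<open>The symmetrized r computes the bracket twice; characteristic zero then allows
    the factor 2 to be cancelled.\<close>
  then have "2 * wact w (pb f f) one = 0"
    using wact_pb[of ?F w] f sw by (simp add: commutator_add_left evl_add)
  then show "wact w (pb f f) one = 0" by simp
qed (use f in auto)

lemma UNIV_three_cyclic: "(UNIV :: 3 set) = {2, 3, 1}" "(UNIV :: 3 set) = {3, 1, 2}"
  unfolding UNIV_three by auto

lemma invariant_triple:
  fixes i j :: 3
  assumes "i \<noteq> j"
  shows "env_eq sc br (commutator (tens i j ts + tens j i ts) (emb i x + emb j x)) 0"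
  using env_eq_place[OF assms invariant[of x]] assms
  by (simp add: place_commutator place_add place_tens place_coprod)

text \<open>For each letter, the part of the coproduct in factor k commutes with everything in the
  factors i, j, and the remaining part is handled by invariance in these two.\<close>

lemma invariant_cop:
  assumes U: "(UNIV :: 3 set) = {i, j, k}" "i \<noteq> j" "k \<noteq> i" "k \<noteq> j"
  shows "env_eq sc br (commutator (tens i j ts + tens j i ts) (cop w)) 0"
proof (rule commutator_cop_null)
  fix x
  have "(\<Sum>s\<in>UNIV. emb s x) = emb i x + emb j x + (emb k x :: ('k, 'l, 3) env_power)"
    unfolding U(1) using U(2) U(3,4)[symmetric] by (simp add: add.assoc)
  then show "env_eq sc br (commutator (tens i j ts + tens j i ts) (\<Sum>s\<in>UNIV. emb s x)) 0"
    using invariant_triple[OF U(2), of x] U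
    by (simp add: commutator_add_left commutator_add_right tens_commute_emb)
qed

lemma commutator_null_right: "env_eq sc br q 0 \<Longrightarrow> env_eq sc br (commutator p q) 0"
  using env_eq_commutator[of sc br p p q 0] by simp

lemma commutator_null_left: "env_eq sc br p 0 \<Longrightarrow> env_eq sc br (commutator p q) 0"
  using env_eq_commutator[of sc br p 0 q q] by simp

lemma pb_jacobi:
  assumes fgh: "f \<in> B" "g \<in> B" "h \<in> B"
  shows "pb f (pb g h) + pb g (pb h f) + pb h (pb f g) = 0"
proof (rule wact_inj)
  show "pb f (pb g h) + pb g (pb h f) + pb h (pb f g) \<in> B"
    using fgh by (intro B_add pb_in)
  fix w
  define F where "F = (\<lambda>s::3. if s = 1 then f else if s = 2 then g else h)"
  have F: "F s \<in> B" for s using fgh by (simp add: F_def)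
  have F_simps: "F 1 = f" "F 2 = g" "F 3 = h" by (simp_all add: F_def)
  let ?t = "\<lambda>i j. tens i j ts :: ('k, 'l, 3) env_power" and ?w = "cop w :: ('k, 'l, 3) env_power"
  let ?e = "commutator (?t 2 3) (commutator (?t 1 2 + ?t 1 3) ?w) +
     commutator (?t 3 1) (commutator (?t 2 3 + ?t 2 1) ?w) + commutator (?t 1 2) (commutator (?t 3 1 + ?t 3 2) ?w)"
  have "wact w (pb f (pb g h) + pb g (pb h f) + pb h (pb f g)) one = evl F ?e"
    using wact_pb_pb[OF UNIV_three, of F w] wact_pb_pb[OF UNIV_three_cyclic(1), of F w]
      wact_pb_pb[OF UNIV_three_cyclic(2), of F w] F fgh
    by (simp add: F_simps evl_add wact_add B_add pb_in)
  also have "\<dots> = evl F 0"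
  proof (rule evl_env_eq[OF F])
    have inv12: "env_eq sc br (commutator (?t 1 2 + ?t 2 1) ?w) 0"
      by (rule invariant_cop[OF UNIV_three]) auto
    have inv13: "env_eq sc br (commutator (?t 1 3 + ?t 3 1) ?w) 0"
      using invariant_cop[OF UNIV_three_cyclic(2)] by (simp add: add.commute)
    have inv23: "env_eq sc br (commutator (?t 2 3 + ?t 3 2) ?w) 0"
      by (rule invariant_cop[OF UNIV_three_cyclic(1)]) auto
    \<comment> \<open>r_13 + r_31 is invariant in the factors 1, 3, and r_23 + r_21 is r with its
      second leg spread over exactly these.\<close>
    have mixed: "env_eq sc br (commutator (?t 1 3 + ?t 3 1) (?t 2 3 + ?t 2 1)) 0"
      using commutator_tens_second[of sc br "?t 1 3 + ?t 3 1" 3 1 2 ts] invariant_triple[of 1 3]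
      by (auto simp: commutator_add_left tens_commute_emb add.commute)
    have null_diff: "env_eq sc br (p - q) 0" if "env_eq sc br p 0" "env_eq sc br q 0"
      for p q :: "('k, 'l, 3) env_power"
      using env_eq_diff[OF that] by simp
    show "env_eq sc br ?e 0"
      unfolding commutator_jacobi_cyclic
      by (intro null_diff env_eq_null_add commutator_null_right[OF inv12] commutator_null_right[OF inv13]
          commutator_null_right[OF inv23] commutator_null_left[OF mixed] commutator_null_left[OF yang_baxter[unfolded cyb_def]])
  qed
  finally show "wact w (pb f (pb g h) + pb g (pb h f) + pb h (pb f g)) one = 0" by simp
qed

text \<open>The commutator with r is a derivation, so it obeys the recursion defining the extended
  cobracket, and the two agree on letters.\<close>

lemma cobracket_word_env_eq:
  "env_eq sc br (cobracket_word \<delta> w) (commutator (tens 1 2 ts) (cop w))"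
proof (induction w)
  case (Cons x w)
  have "env_eq sc br (\<delta> x * prod_list (map coprod w) + coprod x * cobracket_word \<delta> w)
    (commutator (tens 1 2 ts) (coprod x) * prod_list (map coprod w) + coprod x * commutator (tens 1 2 ts) (cop w))"
    using induces by (intro env_eq_add env_eq_mult env_eq_refl Cons) (auto simp: induces_def intro: env_eq_sym)
  then show ?case by (simp add: cop_def commutator_mult_right UNIV_two coprod_def[abs_def])
qed (simp add: cop_def commutator_def)

text \<open>Existence for the description operator is \<open>wact_pb\<close> extended linearly from
  words; uniqueness is injectivity of \<open>to_dual\<close>.\<close>

lemma induced_bracket_eq:
  assumes fg: "f \<in> B" "g \<in> B"
  shows "induced_bracket mult one B D \<delta> f g = pb f g"
  unfolding induced_bracket_def
proof (rule the_equality)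
  define F where "F = (\<lambda>s::2. if s = 1 then f else g)"
  have F: "F s \<in> B" for s using fg by (simp add: F_def)
  have F_simps: "F 1 = f" "F 2 = g" by (simp_all add: F_def)
  have "to_dual mult one D (pb f g) u = dual_bracket \<delta> (to_dual mult one D f) (to_dual mult one D g) u" for u
  proof -
    have "dual_bracket \<delta> (to_dual mult one D f) (to_dual mult one D g) u = evl F (cobracket_ext \<delta> u)"
      by (simp add: dual_bracket_def to_dual_def evl_def UNIV_two F_simps)
    also have "\<dots> = (\<Sum>w\<in>Poly_Mapping.keys u. Poly_Mapping.lookup u w * evl F (cobracket_word \<delta> (letters w)))"
      by (simp add: cobracket_ext_def evl_sum) (simp add: evl_def lin_scalar)
    also have "\<dots> = (\<Sum>w\<in>Poly_Mapping.keys u. Poly_Mapping.lookup u w * wact (letters w) (pb f g) one)"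
    proof (rule sum.cong[OF refl])
      fix w
      have "evl F (cobracket_word \<delta> (letters w)) = wact (letters w) (pb f g) one"
        using evl_env_eq[of F, OF F cobracket_word_env_eq[of "letters w"]] wact_pb[of F "letters w", OF F]
        by (simp add: F_simps)
      then show "Poly_Mapping.lookup u w * evl F (cobracket_word \<delta> (letters w)) =
        Poly_Mapping.lookup u w * wact (letters w) (pb f g) one" by simp
    qed
    finally show ?thesis by (simp add: to_dual_def lin_def)
  qed
  then show *: "pb f g \<in> B \<and> to_dual mult one D (pb f g) = dual_bracket \<delta> (to_dual mult one D f) (to_dual mult one D g)"
    using fg by auto
  fix h assume "h \<in> B \<and> to_dual mult one D h = dual_bracket \<delta> (to_dual mult one D f) (to_dual mult one D g)"
  then show "h = pb f g" using * inj_onD[OF inj_dual] by metis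
qed

lemma poisson_algebra_induced: "poisson_algebra B (induced_bracket mult one B D \<delta>)"
  unfolding poisson_algebra_def
  using subalgebra
  by (auto simp: induced_bracket_eq pb_in B_add B_mult B_const pb_add pb_scale pb_self pb_jacobi pb_mult)

end

section \<open>Powers of the group and the diagonal\<close>

lemma module_functions: "module (\<lambda>(a :: 'k::field_char_0) (F :: 'q \<Rightarrow> 'k) g. a * F g)"
  by unfold_locales (auto simp: fun_eq_iff algebra_simps)

lemma (in regular_functions) L_at_one: "L x f one = D x f"
  by (simp add: act_def)

lemma (in regular_functions) D_zero_index: "f \<in> B \<Longrightarrow> D 0 f = 0"
  using D_add[of f 0 0] by simp

locale power_group = group_functions mult one B sc D br
  for mult :: "'p \<Rightarrow> 'p \<Rightarrow> 'p" and one :: 'p and B :: "('p \<Rightarrow> 'k::field_char_0) set"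
    and sc :: "'k \<Rightarrow> 'l::ab_group_add \<Rightarrow> 'l" and D :: "'l \<Rightarrow> ('p \<Rightarrow> 'k) \<Rightarrow> 'k" and br +
  fixes index :: "'n::finite itself"
begin

abbreviation PB :: "(('n \<Rightarrow> 'p) \<Rightarrow> 'k) set" where "PB \<equiv> power_functions B"

lemma PB_add: "F \<in> PB \<Longrightarrow> G \<in> PB \<Longrightarrow> F + G \<in> PB"
  unfolding power_functions_def by (rule module.span_add[OF module_functions])

lemma PB_scale: "F \<in> PB \<Longrightarrow> (\<lambda>g. a * F g) \<in> PB"
  unfolding power_functions_def by (rule module.span_scale[OF module_functions])

lemma PB_generator: "(\<And>i. f i \<in> B) \<Longrightarrow> (\<lambda>g. \<Prod>i\<in>UNIV. f i (g i)) \<in> PB"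
  unfolding power_functions_def by (rule module.span_base[OF module_functions]) auto

lemma PB_span_induct [consumes 1, case_names zero add scale generator]:
  assumes "F \<in> PB" and zero: "P 0" and add: "\<And>F G. P F \<Longrightarrow> P G \<Longrightarrow> P (F + G)"
    and scale: "\<And>F a. P F \<Longrightarrow> P (\<lambda>g. a * F g)"
    and gen: "\<And>f. (\<And>i. f i \<in> B) \<Longrightarrow> P (\<lambda>g. \<Prod>i\<in>UNIV. f i (g i))"
  shows "P F"
  using assms(1) unfolding power_functions_def
proof (rule module.span_induct_alt[OF module_functions, consumes 1])
  fix a and F G :: "('n \<Rightarrow> 'p) \<Rightarrow> 'k"
  assume "F \<in> {\<lambda>g. \<Prod>i\<in>UNIV. f i (g i) | f. \<forall>i. f i \<in> B}" "P G"
  then show "P ((\<lambda>g. a * F g) + G)" by (auto intro!: add scale gen)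
qed (rule zero)

lemma PB_mult:
  assumes "F \<in> PB" "G \<in> PB"
  shows "F * G \<in> PB"
  using assms(1)
proof (induction F rule: PB_span_induct)
  case zero
  show ?case using PB_scale[OF assms(1), of 0] by (simp add: zero_fun_def times_fun_def)
next
  case (add F F')
  then show ?case unfolding distrib_right by (rule PB_add)
next
  case (scale F a)
  then show ?case using PB_scale[of "F * G" a] by (simp add: times_fun_def mult.assoc)
next
  case (generator f)
  show ?case using assms(2)
  proof (induction G rule: PB_span_induct)
    case zero
    show ?case using PB_scale[OF assms(1), of 0] by (simp add: zero_fun_def times_fun_def)
  next
    case (add F F')
    then show ?case unfolding distrib_left by (rule PB_add)
  next
    case (scale F a)
    then show ?case using PB_scale[of "_ * F" a] by (simp add: times_fun_def mult.left_commute)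
  next
    case (generator f')
    have "(\<lambda>g. \<Prod>i\<in>UNIV. f i (g i)) * (\<lambda>g. \<Prod>i\<in>UNIV. f' i (g i)) = (\<lambda>g. \<Prod>i\<in>UNIV. (f i * f' i) (g i))"
      by (simp add: fun_eq_iff prod.distrib)
    then show ?case using PB_generator[of "\<lambda>i. f i * f' i"] generator \<open>\<And>i. f i \<in> B\<close> by auto
  qed
qed

lemma PB_const: "(\<lambda>_. a) \<in> PB"
  using PB_scale[OF PB_generator[of "\<lambda>_ _. 1"], of a] by (simp add: B_const)

lemma PB_coordinate:
  assumes "f \<in> B"
  shows "(\<lambda>g. f (g i)) \<in> PB"
proof -
  have "(\<lambda>g. \<Prod>j\<in>UNIV. (if j = i then f else 1) (g j)) \<in> PB"
    by (rule PB_generator) (use assms in auto)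
  moreover have "(\<Prod>j\<in>UNIV. (if j = i then f else 1) (g j)) = f (g i)" for g :: "'n \<Rightarrow> 'p"
  proof -
    have "(\<Prod>j\<in>UNIV. (if j = i then f else 1) (g j)) = (\<Prod>j\<in>UNIV. if j = i then f (g j) else 1)"
      by (rule prod.cong) auto
    then show ?thesis by simp
  qed
  ultimately show ?thesis by simp
qed

text \<open>The functions on the power are generated as an algebra by pullbacks from single
  coordinates, so derivation identities need only be checked there. Membership in \<open>PB\<close>
  is handed to the induction steps because the product rules ask for it.\<close>

lemma PB_induct [consumes 1, case_names const coordinate add mult]:
  assumes "F \<in> PB" and const: "\<And>a. P (\<lambda>_. a)" and coord: "\<And>f i. f \<in> B \<Longrightarrow> P (\<lambda>g. f (g i))"
    and add: "\<And>F G. F \<in> PB \<Longrightarrow> G \<in> PB \<Longrightarrow> P F \<Longrightarrow> P G \<Longrightarrow> P (F + G)"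
    and mult: "\<And>F G. F \<in> PB \<Longrightarrow> G \<in> PB \<Longrightarrow> P F \<Longrightarrow> P G \<Longrightarrow> P (F * G)"
  shows "P F"
proof -
  have "F \<in> PB \<and> P F"
    using assms(1)
  proof (induction F rule: PB_span_induct)
    case zero
    show ?case using const[of 0] PB_const[of 0] by (simp add: zero_fun_def)
  next
    case (scale F a)
    then show ?case using mult[OF PB_const[of a] _ const[of a]] PB_scale by (simp add: times_fun_def)
  next
    case (generator f)
    have "(\<lambda>g. \<Prod>i\<in>S. f i (g i)) \<in> PB \<and> P (\<lambda>g. \<Prod>i\<in>S. f i (g i))" for S :: "'n set"
    proof (induction S rule: infinite_finite_induct)
      case (insert j S)
      have "(\<lambda>g. \<Prod>i\<in>insert j S. f i (g i)) = (\<lambda>g. f j (g j)) * (\<lambda>g. \<Prod>i\<in>S. f i (g i))"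
        using insert by (simp add: fun_eq_iff)
      then show ?case
        using mult[of "\<lambda>g. f j (g j)" "\<lambda>g. \<Prod>i\<in>S. f i (g i)"] coord PB_coordinate PB_mult generator insert
        by simp
    qed (simp_all add: const PB_const)
    then show ?case .
  next
    case (add F G)
    then show ?case using assms(4)[of F G] PB_add[of F G] by blast
  qed
  then show ?thesis ..
qed

text \<open>Freezing all coordinates but one yields a function on which \<open>D\<close> can act: at
  the identity this serves \<open>power_derivation\<close>, at other points it serves to transfer
  injectivity.\<close>

lemma PB_slice: "F \<in> PB \<Longrightarrow> (\<lambda>h. F (g(i := h))) \<in> B"
proof (induction F rule: PB_induct)
  case (coordinate f j)
  then show ?case by (cases "i = j") auto
next
  case (add F G)
  then show ?case using B_add by (fastforce simp: plus_fun_def)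
next
  case (mult F G)
  then show ?case using B_mult by (fastforce simp: times_fun_def)
qed auto

lemma PB_diagonal: "F \<in> PB \<Longrightarrow> (\<lambda>p. F (\<lambda>_. p)) \<in> B"
proof (induction F rule: PB_induct)
  case (add F G)
  then show ?case using B_add by (fastforce simp: plus_fun_def)
next
  case (mult F G)
  then show ?case using B_mult by (fastforce simp: times_fun_def)
qed auto

lemma PB_mult_regular:
  "F \<in> PB \<Longrightarrow> \<exists>ts. set ts \<subseteq> PB \<times> PB \<and> (\<forall>g h. F (power_mult mult g h) = (\<Sum>(a, b)\<leftarrow>ts. a g * b h))"
proof (induction F rule: PB_induct)
  case (const a)
  show ?case by (rule exI[of _ "[(\<lambda>_. a, \<lambda>_. 1)]"]) (simp add: PB_const)
next
  case (coordinate f i)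
  then obtain ts where ts: "set ts \<subseteq> B \<times> B" "\<And>g h. f (mult g h) = (\<Sum>(a, b)\<leftarrow>ts. a g * b h)"
    using mult_regular by metis
  show ?case
    by (rule exI[of _ "map (\<lambda>(a, b). (\<lambda>g. a (g i), \<lambda>g. b (g i))) ts"])
      (use ts in \<open>auto simp: power_mult_def o_def case_prod_unfold intro!: PB_coordinate\<close>)
next
  case (add F G)
  then obtain ts us where "set ts \<subseteq> PB \<times> PB" "\<forall>g h. F (power_mult mult g h) = (\<Sum>(a, b)\<leftarrow>ts. a g * b h)"
    "set us \<subseteq> PB \<times> PB" "\<forall>g h. G (power_mult mult g h) = (\<Sum>(a, b)\<leftarrow>us. a g * b h)"
    by metis
  then show ?case by (intro exI[of _ "ts @ us"]) simp
next
  case (mult F G)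
  then obtain ts us where ts: "set ts \<subseteq> PB \<times> PB" "\<And>g h. F (power_mult mult g h) = (\<Sum>(a, b)\<leftarrow>ts. a g * b h)"
    and us: "set us \<subseteq> PB \<times> PB" "\<And>g h. G (power_mult mult g h) = (\<Sum>(a, b)\<leftarrow>us. a g * b h)"
    by metis
  define vs where "vs = concat (map (\<lambda>(a, b). map (\<lambda>(a', b'). (a * a', b * b')) us) ts)"
  have row: "(\<Sum>x\<leftarrow>us. a g * fst x g * (b h * snd x h)) = a g * b h * (\<Sum>x\<leftarrow>us. fst x g * snd x h)" for a b g h
    unfolding sum_list_const_mult[symmetric] by (simp add: algebra_simps)
  have "(\<Sum>(a, b)\<leftarrow>vs. a g * b h) = (\<Sum>(a, b)\<leftarrow>ts. a g * b h) * (\<Sum>(a, b)\<leftarrow>us. a g * b h)" for g h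
    unfolding vs_def by (induction ts) (auto simp: o_def case_prod_unfold distrib_right row)
  moreover have "set vs \<subseteq> PB \<times> PB"
  proof -
    have "a \<in> PB \<and> b \<in> PB" if "(a, b) \<in> set ts \<union> set us" for a b
      using that ts(1) us(1) by blast
    then show ?thesis by (auto simp: vs_def intro!: PB_mult[unfolded times_fun_def] PB_mult)
  qed
  ultimately show ?case using ts(2) us(2) by (intro exI[of _ vs]) simp
qed

sublocale power: regular_functions "power_mult mult" "\<lambda>_. one" PB "power_sc sc" "power_derivation one D"
proof
  show "function_subalgebra PB"
    by (simp add: function_subalgebra_def PB_const PB_add PB_mult)
  fix x y :: "'n \<Rightarrow> 'l" and F a
  show "F \<in> PB \<Longrightarrow> power_derivation one D (x + y) F = power_derivation one D x F + power_derivation one D y F"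
    by (simp add: power_derivation_def D_add PB_slice sum.distrib)
  show "F \<in> PB \<Longrightarrow> power_derivation one D (power_sc sc a x) F = a * power_derivation one D x F"
    by (simp add: power_derivation_def power_sc_def D_scale PB_slice sum_distrib_left)
next
  fix x :: "'n \<Rightarrow> 'l"
  let ?s = "\<lambda>F i h. F ((\<lambda>_. one)(i := h))"
  have "power_derivation one D x (F + G) = power_derivation one D x F + power_derivation one D x G"
    if "F \<in> PB" "G \<in> PB" for F G
  proof -
    have "D (x i) (?s (F + G) i) = D (x i) (?s F i) + D (x i) (?s G i)" for i
      using D_fun_add[OF PB_slice[OF that(1)] PB_slice[OF that(2)], of "x i" "\<lambda>_. one" i "\<lambda>_. one" i]
      by (simp add: plus_fun_def)
    then show ?thesis
      by (simp add: power_derivation_def sum.distrib)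
  qed
  moreover have "power_derivation one D x (\<lambda>g. a * F g) = a * power_derivation one D x F" if "F \<in> PB" for a F
    using that by (simp add: power_derivation_def D_fun_scale PB_slice sum_distrib_left)
  moreover have "power_derivation one D x (F * G) =
     power_derivation one D x F * G (\<lambda>_. one) + F (\<lambda>_. one) * power_derivation one D x G"
    if "F \<in> PB" "G \<in> PB" for F G
  proof -
    have 1: "(\<lambda>_. one)(i := one) = (\<lambda>_. one)" for i :: 'n by auto
    have "D (x i) (?s (F * G) i) = D (x i) (?s F i) * G (\<lambda>_. one) + F (\<lambda>_. one) * D (x i) (?s G i)" for i
      using D_fun_mult[OF PB_slice[OF that(1)] PB_slice[OF that(2)], of "x i" "\<lambda>_. one" i "\<lambda>_. one" i]
      by (simp add: times_fun_def 1)
    then show ?thesis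
      by (simp add: power_derivation_def sum.distrib sum_distrib_left sum_distrib_right)
  qed
  ultimately show "point_derivation (\<lambda>_. one) PB (power_derivation one D x)"
    by (simp add: point_derivation_def)
qed (erule PB_mult_regular | simp add: power_mult_def assoc)+

lemma power_D_coordinate:
  "f \<in> B \<Longrightarrow> power_derivation one D X (\<lambda>g. f (g i)) = D (X i) f"
proof -
  assume "f \<in> B"
  have "power_derivation one D X (\<lambda>g. f (g i)) = (\<Sum>j\<in>UNIV. if j = i then D (X i) f else 0)"
    unfolding power_derivation_def by (rule sum.cong) auto
  then show ?thesis by simp
qed

lemma power_L_coordinate:
  assumes "f \<in> B"
  shows "power.L X (\<lambda>g. f (g i)) = (\<lambda>g. L (X i) f (g i))"
proof
  fix g
  show "power.L X (\<lambda>g. f (g i)) g = L (X i) f (g i)"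
    using power_D_coordinate[OF translate_left[OF assms, of "g i"], of X i]
    by (simp add: act_def power_mult_def)
qed

text \<open>An element of summand i moves only coordinate i; the remaining terms of the derivation
  are values of \<open>D 0\<close>.\<close>

lemma power_L_slice:
  assumes H: "H \<in> PB"
  shows "L x (\<lambda>p. H (g(i := p))) = (\<lambda>p. power.L (incl i x) H (g(i := p)))"
proof
  fix p
  have "power.L (incl i x) H (g(i := p)) = (\<Sum>j\<in>UNIV. if j = i then D x (\<lambda>h. H (g(i := mult p h))) else 0)"
    unfolding act_def power_derivation_def
  proof (rule sum.cong[OF refl])
    fix j
    have "(\<lambda>h. H (power_mult mult (g(i := p)) ((\<lambda>_. one)(j := h)))) \<in> B"
      by (rule PB_slice[OF power.translate_left[OF H]])
    moreover have "power_mult mult (g(i := p)) ((\<lambda>_. one)(i := h)) = g(i := mult p h)" for h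
      by (auto simp: power_mult_def fun_eq_iff)
    ultimately show "D (incl i x j) (\<lambda>h. H (power_mult mult (g(i := p)) ((\<lambda>_. one)(j := h)))) =
        (if j = i then D x (\<lambda>h. H (g(i := mult p h))) else 0)"
      by (auto simp: incl_def D_zero_index)
  qed
  then show "L x (\<lambda>p. H (g(i := p))) p = power.L (incl i x) H (g(i := p))"
    by (simp add: act_def)
qed

lemma power_wact_slice:
  "H \<in> PB \<Longrightarrow> wact u (\<lambda>p. H (g(i := p))) = (\<lambda>p. power.wact (map (incl i) u) H (g(i := p)))"
  by (induction u) (auto simp: power_L_slice power.wact_in)

text \<open>The coordinates are moved away from the identity one at a time, so that injectivity on the factor applies.\<close>

lemma power_wact_zero:
  assumes F: "F \<in> PB" and zero: "\<And>w. power.wact w F (\<lambda>_. one) = 0"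
  shows "F = 0"
proof -
  have "power.wact w F g = 0" if "\<And>i. i \<notin> S \<Longrightarrow> g i = one" for S :: "'n set" and w g
    using finite[of S] that
  \<comment> \<open>\<open>w\<close> stays arbitrary because testing coordinate i prefixes a word in
    summand i to it.\<close>
  proof (induction S arbitrary: w g rule: finite_induct)
    case empty
    then have "g = (\<lambda>_. one)" by auto
    then show ?case using zero by simp
  next
    case (insert i S)
    let ?\<phi> = "\<lambda>p. power.wact w F (g(i := p))"
    have "?\<phi> = 0"
    proof (rule wact_inj)
      show "?\<phi> \<in> B" by (intro PB_slice power.wact_in F)
      fix u
      have "wact u ?\<phi> one = power.wact (map (incl i) u @ w) F (g(i := one))"
        using power_wact_slice[OF power.wact_in[OF F]] by simp
      also have "\<dots> = 0"
        by (rule insert.IH) (use insert.prems in auto)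
      finally show "wact u ?\<phi> one = 0" .
    qed
    then have "?\<phi> (g i) = 0 (g i)" by (rule fun_cong)
    then show ?case by simp
  qed
  from this[of UNIV _ "[]"] show ?thesis by (simp add: fun_eq_iff)
qed

sublocale power: group_functions "power_mult mult" "\<lambda>_. one" PB "power_sc sc" "power_derivation one D" "power_br br"
proof
  fix F x y assume "F \<in> PB"
  then show "power_derivation one D (power_br br x y) F =
    power_derivation one D x (power.L y F) - power_derivation one D y (power.L x F)"
  proof (induction F rule: PB_induct)
    case (coordinate f i)
    then show ?case
      using D_bracket[of f "x i" "y i"]
      by (simp add: power_L_coordinate power_D_coordinate L_in power_br_def)
  next
    case (add F G)
    then show "power_derivation one D (power_br br x y) (F + G) =
      power_derivation one D x (power.L y (F + G)) - power_derivation one D y (power.L x (F + G))"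
      by (simp add: power.D_fun_add power.L_add power.L_in)
  next
    case (mult F G)
    \<comment> \<open>The cross terms are products of first derivatives of F and G at the identity;
      they are symmetric in x and y and cancel.\<close>
    show "power_derivation one D (power_br br x y) (F * G) =
      power_derivation one D x (power.L y (F * G)) - power_derivation one D y (power.L x (F * G))"
      using mult.hyps
      by (simp add: power.D_fun_add power.D_fun_mult power.L_mult power.L_in power.B_mult power.L_at_one mult.IH algebra_simps)
  qed (simp add: zero_fun_def)
next
  show "inj_on (to_dual (power_mult mult) (\<lambda>_. one) (power_derivation one D)) PB"
  proof (rule inj_onI)
    fix F G assume FG: "F \<in> PB" "G \<in> PB"
      and eq: "to_dual (power_mult mult) (\<lambda>_. one) (power_derivation one D) F =
         to_dual (power_mult mult) (\<lambda>_. one) (power_derivation one D) G"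
    have "F - G = 0"
    proof (rule power_wact_zero)
      fix w
      show "power.wact w (F - G) (\<lambda>_. one) = 0"
        using fun_cong[OF eq, of "Poly_Mapping.single (Monomial w) 1"] FG
        by (simp add: to_dual_def power.wact_diff)
    qed (use FG in auto)
    then show "F = G" by simp
  qed
qed

section \<open>Restriction to the diagonal\<close>

lemma L_diagonal:
  "F \<in> PB \<Longrightarrow> L x (\<lambda>p. F (\<lambda>_. p)) = (\<lambda>p. power.L (\<lambda>_. x) F (\<lambda>_. p))"
proof (induction F rule: PB_induct)
  case (coordinate f i)
  then show ?case by (simp add: power_L_coordinate)
next
  case (add F G)
  then show "L x (\<lambda>p. (F + G) (\<lambda>_. p)) = (\<lambda>p. power.L (\<lambda>_. x) (F + G) (\<lambda>_. p))"
    using L_add[OF PB_diagonal PB_diagonal, of F G x] by (simp add: power.L_add) (simp add: plus_fun_def)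
next
  case (mult F G)
  then show "L x (\<lambda>p. (F * G) (\<lambda>_. p)) = (\<lambda>p. power.L (\<lambda>_. x) (F * G) (\<lambda>_. p))"
    using L_mult[OF PB_diagonal PB_diagonal, of F G x] by (simp add: power.L_mult) (simp add: times_fun_def plus_fun_def)
qed (simp add: zero_fun_def)

lemma wact_diagonal:
  "F \<in> PB \<Longrightarrow> wact w (\<lambda>p. F (\<lambda>_. p)) = (\<lambda>p. power.wact (map (\<lambda>x _. x) w) F (\<lambda>_. p))"
  by (induction w) (auto simp: L_diagonal power.wact_in)

text \<open>Restriction of functions to the diagonal is the transpose of the map induced by x to (x,
  ..., x); this turns congruences over the power into equations for functions on the group.\<close>

lemma evl_transport_diagonal:
  assumes "\<And>i. T i \<in> PB"
  shows "power.evl T (transport (\<lambda>_ x _. x) p) = evl (\<lambda>i p. T i (\<lambda>_. p)) p"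
  unfolding power.evl_def evl_def transport_def lin_push
  using wact_diagonal[OF assms] by (simp add: monomial.map_sel)

end

lemma transport_cop:
  "transport (\<lambda>_. h) (cop w) = (cop (map h w) :: ('k::field_char_0, 'm, 'i::finite) env_power)"
proof (induction w)
  case (Cons x w)
  have "transport (\<lambda>_. h) (\<Sum>i\<in>S. emb i x) = (\<Sum>i\<in>S. emb i (h x) :: ('k, 'm, 'i) env_power)" for S
    by (induction S rule: infinite_finite_induct) (auto simp: transport_add)
  then show ?case using Cons by (simp add: cop_def transport_mult)
qed (simp add: cop_def)

text \<open>The blocks need not sum to the diagonal image of \<open>ts\<close>, but by
  \<open>blocks_diagonal\<close> the difference commutes with the coproduct of each diagonal letter,
  hence with that of each word in such letters.\<close>

lemma (in r_array) commutator_blocks_diagonal: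
  assumes ts: "induces sc br \<delta> ts"
  shows "eqn (commutator (tens (1::2) 2 blocks) (cop (map (\<lambda>x _. x) w)))
    (transport (\<lambda>_ x _. x) (commutator (tens 1 2 ts) (cop w)))"
proof -
  let ?d = "\<lambda>_ x _. x"
  let ?t = "tens 1 2 blocks - transport ?d (tens 1 2 ts) :: ('k, 'n \<Rightarrow> 'l, 2) env_power"
  have "eqn (commutator ?t (coprod (\<lambda>_. x))) 0" for x
  proof -
    have "eqn (transport ?d (commutator (tens 1 2 ts) (coprod x))) (transport ?d (\<delta> x))"
      by (rule env_eq_transport[OF lie_hom_diagonal]) (use ts in \<open>simp add: induces_def\<close>)
    from env_eq_diff[OF blocks_diagonal[of x] this] show ?thesis
      by (simp add: transport_commutator coprod_def transport_add commutator_diff_left)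
  qed
  then have "eqn (commutator ?t (cop (map (\<lambda>x _. x) w))) 0"
    unfolding cop_def by (intro commutator_prod_list_null) (auto simp: UNIV_two coprod_def)
  then show ?thesis
    by (simp add: transport_commutator transport_cop commutator_diff_left env_eq_iff_diff[of _ _ "commutator _ _"])
qed

theorem theorem1p6:
  fixes sc :: "'k::field_char_0 \<Rightarrow> 'g::ab_group_add \<Rightarrow> 'g"
    and br :: "'g \<Rightarrow> 'g \<Rightarrow> 'g"
    and \<delta> :: "'g \<Rightarrow> ('k, 'g, 2) env_power"
    and r :: "'c \<Rightarrow> ('k, 'g, 2) env_power"
    and c :: "'n::{finite,linorder} \<Rightarrow> 'n \<Rightarrow> 'c"
    and d :: "'n \<Rightarrow> 'c"
    and mult :: "'p \<Rightarrow> 'p \<Rightarrow> 'p" and one :: 'p and inv :: "'p \<Rightarrow> 'p"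
    and A :: "('p \<Rightarrow> 'k) set"
    and D :: "'g \<Rightarrow> ('p \<Rightarrow> 'k) \<Rightarrow> 'k"
  assumes "lie_bialgebra sc br \<delta>"
    and "\<And>a. r_matrix sc br \<delta> (r a)"
    and "CARD('n) > 1"
    and "transitive_array c"
    and "algebraic_group mult one inv A"
    and "lie_algebra_of_group mult one A sc br D"
    and "inj_on (to_dual mult one D) A"
  shows "poisson_hom
           (power_functions A)
           (induced_bracket (power_mult mult) (\<lambda>_. one) (power_functions A) (power_derivation one D)
              (array_cobracket r c d))
           A
           (induced_bracket mult one A D \<delta>)
           (\<lambda>F g. F (\<lambda>_. g))"
proof -
  interpret g: lie_bialgebra sc br \<delta> by fact
  interpret G: algebraic_group mult one inv A by fact
  interpret power_group mult one A sc D br "TYPE('n)"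
    using assms(6,7) G.subalgebra G.mult_regular
    by unfold_locales (auto simp: lie_algebra_of_group_def G.assoc)
  obtain \<rho> where \<rho>: "r_array sc br \<delta> \<rho>"
    "env_eq (power_sc sc) (power_br br) (regroup (array_r r c d)) (tens 1 2 (r_array.blocks \<rho>))"
    by (rule g.array_lists[of r c d, OF assms(2,4)])
  interpret r_array sc br \<delta> \<rho> by fact
  \<comment> \<open>One member of the family serves for the group. As all members induce
    \<open>\<delta>\<close>, it does not have to match any particular block.\<close>
  obtain ts where ts: "induces sc br \<delta> ts" "env_eq sc br (cyb ts ts ts) 0"
    using g.r_matrix_list[OF assms(2)] by metis
  interpret P: poisson_group mult one A sc D br \<delta> ts
    using ts g.induces_symmetric_invariant[OF ts(1), of "1::2" 2]
    by unfold_locales (auto simp: coprod_def)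
  \<comment> \<open>The array cobracket is by definition the commutator with the regrouped r-matrix,
    so the congruence of the latter with \<open>blocks\<close> gives \<open>induces\<close>.\<close>
  interpret Q: poisson_group "power_mult mult" "\<lambda>_. one" PB "power_sc sc" "power_derivation one D" "power_br br"
    "array_cobracket r c d" blocks
    using \<rho>(2) blocks_symmetric_invariant cyb_blocks
    by unfold_locales (auto simp: induces_def array_cobracket_def intro!: env_eq_commutator intro: env_eq_sym)
  have hom: "(\<lambda>p. Q.pb F G (\<lambda>_. p)) = P.pb (\<lambda>p. F (\<lambda>_. p)) (\<lambda>p. G (\<lambda>_. p))" (is "?l = ?r")
    if FG: "F \<in> PB" "G \<in> PB" for F G
  proof -
    have lr: "?l \<in> A" "?r \<in> A"
      using PB_diagonal[OF Q.pb_in[OF FG]] P.pb_in[OF PB_diagonal PB_diagonal, OF FG] by simp_all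
    define T where "T = (\<lambda>s::2. if s = 1 then F else G)"
    have T: "T s \<in> PB" for s using FG by (simp add: T_def)
    have T_simps: "T 1 = F" "T 2 = G" by (simp_all add: T_def)
    \<comment> \<open>Paired with words at the identity, the two sides become the two sides of
      \<open>commutator_blocks_diagonal\<close>.\<close>
    have "?l - ?r = 0"
    proof (rule wact_inj)
      fix w
      have "wact w ?l one = power.wact (map (\<lambda>x _. x) w) (Q.pb F G) (\<lambda>_. one)"
        using wact_diagonal[OF Q.pb_in[OF FG]] by simp
      also have "\<dots> = power.evl T (commutator (tens 1 2 blocks) (cop (map (\<lambda>x _. x) w)))"
        using Q.wact_pb[of T, OF T] by (simp add: T_simps)
      also have "\<dots> = power.evl T (transport (\<lambda>_ x _. x) (commutator (tens 1 2 ts) (cop w)))"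
        by (rule power.evl_env_eq[OF T commutator_blocks_diagonal[OF ts(1)]])
      also have "\<dots> = evl (\<lambda>i p. T i (\<lambda>_. p)) (commutator (tens 1 2 ts) (cop w))"
        by (rule evl_transport_diagonal[OF T])
      also have "\<dots> = wact w ?r one"
        using P.wact_pb[of "\<lambda>i p. T i (\<lambda>_. p)", OF PB_diagonal[OF T]] by (simp add: T_simps)
      finally show "wact w (?l - ?r) one = 0" using lr by (simp add: wact_diff)
    qed (use lr in auto)
    then show ?thesis by simp
  qed
  show ?thesis
    unfolding poisson_hom_def
    using P.poisson_algebra_induced Q.poisson_algebra_induced
    by (simp add: PB_diagonal plus_fun_def times_fun_def P.induced_bracket_eq Q.induced_bracket_eq hom)
qed

end
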